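(* For each $n$ let $A$ be generated by a degree corrected block model $(g,B,\psi)$ on $n$ nodes and $K$ communities (all parameters may depend on $n$), and let $K_0$ be a positive integer. If there exists $1\le k^*\le K$ such that $\mathcal E(\tilde\phi_{k^*},K_0)>0$, then for any estimator $(\hat g,\hat B)$ of a stochastic block model with $K_0$ communities, the associated empirically centered and rescaled adjacency matrix $\tilde A$ satisfies, as $n\to\infty$, $$\|\tilde A\|\ \ge\ \frac{\mathcal E(\tilde\phi_{k^*},K_0)}{2K_0^{3/2}}\,\|B_{k^*,\cdot}\|_\infty\,\kappa_n\,n^{1/2}+O_P(1),$$ where $\kappa_n=\min_{1\le k\le K}\|\phi_k\|^2/n$ and $\|B_{k^*,\cdot}\|_\infty=\max_{1\le k\le K}B_{k^*,k}$.
   Context: Degree corrected block model $(g,B,\psi)$ with $g\in\{1,\dots,K\}^n$, $B\in[0,1]^{K\times K}$ symmetric and node activeness parameter $\psi\in[0,1]^n$: the adjacency matrix $A$ is a random symmetric binary $n\times n$ matrix with zero diagonal whose entries $A_{ij}$, $i<j$, are independent Bernoulli with parameter $\psi_i\psi_jB_{g_ig_j}$. $\phi_k$ is the subvector of $\psi$ consisting of the entries $\psi_i$ with $g_i=k$, and $\tilde\phi_k=\phi_k/\|\phi_k\|$ (Euclidean norm). For a vector $v$ and positive integer $L$, $$\mathcal E(v,L)=\min\{\|v-u\|_2^2:\ \text{the entries of } u \text{ take at most } L \text{ distinct values}\},$$ where $u$ ranges over real vectors of the same length as $v$. An estimator $(\hat g,\hat B)$ of a stochastic block model with $K_0$ communities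 is a pair of functions of the data with $\hat g\in\{1,\dots,K_0\}^n$ and $\hat B$ a symmetric $K_0\times K_0$ matrix with entries in $[0,1]$ (for example the plug-in block averages of $A$ given $\hat g$). Put $\hat P_{ij}=\hat B_{\hat g_i\hat g_j}$. The matrix $\tilde A$ is defined by $\tilde A_{ii}=0$ and $\tilde A_{ij}=\frac{A_{ij}-\hat P_{ij}}{\sqrt{(n-1)\hat P_{ij}(1-\hat P_{ij})}}$ for $i\neq j$, with the conventions $0/0=0$, and $\|\tilde A\|=+\infty$ if $\hat P_{ij}\in\{0,1\}$ and $A_{ij}\ne\hat P_{ij}$ for some $i\ne j$. $\|\cdot\|$ applied to a matrix is the spectral norm (largest singular value). The inequality with $O_P(1)$ means that it holds with some sequence of random variables bounded in probability in place of $O_P(1)$. *)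

theory Defs
  imports
    "HOL-Probability.Probability"
    "Jordan_Normal_Form.Char_Poly"
begin

text \<open>Nodes are \<open>0, \<dots>, n - 1\<close> (the index range of an \<open>n \<times> n\<close> matrix); community labels are
  \<open>1, \<dots>, K\<close>. A vector indexed by a finite set \<open>I\<close> of nodes is a function that is only evaluated
  on \<open>I\<close>; its Euclidean norm is \<^term>\<open>L2_set v I\<close>.\<close>

definition adjacency_matrices :: "nat \<Rightarrow> real mat set" where
  "adjacency_matrices n = {a \<in> carrier_mat n n.
     (\<forall>i<n. \<forall>j<n. a $$ (i, j) \<in> {0, 1} \<and> a $$ (i, j) = a $$ (j, i)) \<and>
     (\<forall>i<n. a $$ (i, i) = 0)}"

definition sbm_parameters ::
    "nat \<Rightarrow> nat \<Rightarrow> (nat \<Rightarrow> nat) \<Rightarrow> (nat \<Rightarrow> nat \<Rightarrow> real) \<Rightarrow> bool" where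
  "sbm_parameters n K g B \<longleftrightarrow>
     (\<forall>i<n. g i \<in> {1..K}) \<and>
     (\<forall>k\<in>{1..K}. \<forall>l\<in>{1..K}. B k l \<in> {0..1} \<and> B k l = B l k)"

definition dcbm ::
    "'w measure \<Rightarrow> nat \<Rightarrow> nat \<Rightarrow> (nat \<Rightarrow> nat) \<Rightarrow> (nat \<Rightarrow> nat \<Rightarrow> real) \<Rightarrow> (nat \<Rightarrow> real) \<Rightarrow>
     ('w \<Rightarrow> real mat) \<Rightarrow> bool" where
  "dcbm M n K g B \<psi> A \<longleftrightarrow>
     prob_space M \<and> sbm_parameters n K g B \<and> (\<forall>i<n. \<psi> i \<in> {0..1}) \<and>
     (\<forall>\<omega>\<in>space M. A \<omega> \<in> adjacency_matrices n) \<and>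
     prob_space.indep_vars M (\<lambda>_. borel) (\<lambda>(i, j) \<omega>. A \<omega> $$ (i, j)) {(i, j). i < j \<and> j < n} \<and>
     (\<forall>i j. i < j \<and> j < n \<longrightarrow>
        measure M {\<omega> \<in> space M. A \<omega> $$ (i, j) = 1} = \<psi> i * \<psi> j * B (g i) (g j))"

definition community :: "nat \<Rightarrow> (nat \<Rightarrow> nat) \<Rightarrow> nat \<Rightarrow> nat set" where
  "community n g k = {i. i < n \<and> g i = k}"

text \<open>\<open>\<parallel>\<phi>\<^sub>k\<parallel>\<close>, where \<open>\<phi>\<^sub>k\<close> is \<open>\<psi>\<close> restricted to community \<open>k\<close>.\<close>

definition phi_norm :: "nat \<Rightarrow> (nat \<Rightarrow> nat) \<Rightarrow> (nat \<Rightarrow> real) \<Rightarrow> nat \<Rightarrow> real" where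
  "phi_norm n g \<psi> k = L2_set \<psi> (community n g k)"

text \<open>The vector \<open>\<phi>\<^sub>k / \<parallel>\<phi>\<^sub>k\<parallel>\<close>, to be read on the index set \<^term>\<open>community n g k\<close>.\<close>

definition phi_tilde :: "nat \<Rightarrow> (nat \<Rightarrow> nat) \<Rightarrow> (nat \<Rightarrow> real) \<Rightarrow> nat \<Rightarrow> nat \<Rightarrow> real" where
  "phi_tilde n g \<psi> k = (\<lambda>i. \<psi> i / phi_norm n g \<psi> k)"

text \<open>\<open>\<E>(v, L)\<close> for a vector \<open>v\<close> indexed by the finite set \<open>I\<close>. For \<open>L \<ge> 1\<close> the infimum is attained
  (there are finitely many ways to group the entries, and a best approximation for each).\<close>

definition approx_error :: "nat set \<Rightarrow> (nat \<Rightarrow> real) \<Rightarrow> nat \<Rightarrow> real" where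
  "approx_error I v L = Inf {(L2_set (\<lambda>i. v i - u i) I)\<^sup>2 | u. card (u ` I) \<le> L}"

definition kappa :: "nat \<Rightarrow> nat \<Rightarrow> (nat \<Rightarrow> nat) \<Rightarrow> (nat \<Rightarrow> real) \<Rightarrow> real" where
  "kappa n K g \<psi> = Min ((\<lambda>k. (phi_norm n g \<psi> k)\<^sup>2 / real n) ` {1..K})"

definition row_max :: "nat \<Rightarrow> (nat \<Rightarrow> nat \<Rightarrow> real) \<Rightarrow> nat \<Rightarrow> real" where
  "row_max K B k = Max (B k ` {1..K})"

text \<open>An estimator is a function of the observed adjacency matrix. The set of adjacency matrices is
  finite, so no measurability condition is needed.\<close>

definition sbm_estimator ::
    "nat \<Rightarrow> nat \<Rightarrow> (real mat \<Rightarrow> nat \<Rightarrow> nat) \<Rightarrow> (real mat \<Rightarrow> nat \<Rightarrow> nat \<Rightarrow> real) \<Rightarrow> bool" where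
  "sbm_estimator n K0 ghat Bhat \<longleftrightarrow>
     (\<forall>a\<in>adjacency_matrices n. sbm_parameters n K0 (ghat a) (Bhat a))"

definition P_hat ::
    "(real mat \<Rightarrow> nat \<Rightarrow> nat) \<Rightarrow> (real mat \<Rightarrow> nat \<Rightarrow> nat \<Rightarrow> real) \<Rightarrow> real mat \<Rightarrow> nat \<Rightarrow> nat \<Rightarrow> real" where
  "P_hat ghat Bhat a i j = Bhat a (ghat a i) (ghat a j)"

definition singular_values :: "real mat \<Rightarrow> real set" where
  "singular_values X = {\<sigma>. \<sigma> \<ge> 0 \<and> eigenvalue (transpose_mat X * X) (\<sigma>\<^sup>2)}"

definition spectral_norm :: "real mat \<Rightarrow> real" where
  "spectral_norm X = Max (singular_values X)"

text \<open>Division by zero yields \<open>0\<close>, which is the convention \<open>0 / 0 = 0\<close> when the numerator vanishes;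
  the other case is treated separately in \<open>A_tilde_norm\<close>.\<close>

definition A_tilde :: "nat \<Rightarrow> (nat \<Rightarrow> nat \<Rightarrow> real) \<Rightarrow> real mat \<Rightarrow> real mat" where
  "A_tilde n P a = mat n n (\<lambda>(i, j).
     if i = j then 0
     else (a $$ (i, j) - P i j) / sqrt ((real n - 1) * P i j * (1 - P i j)))"

definition A_tilde_norm :: "nat \<Rightarrow> (nat \<Rightarrow> nat \<Rightarrow> real) \<Rightarrow> real mat \<Rightarrow> ereal" where
  "A_tilde_norm n P a =
     (if \<exists>i<n. \<exists>j<n. i \<noteq> j \<and> P i j \<in> {0, 1} \<and> a $$ (i, j) \<noteq> P i j then \<infinity>
      else ereal (spectral_norm (A_tilde n P a)))"

text \<open>\<open>R\<^sub>n = O\<^sub>P(1)\<close>; the \<open>n\<close>-th random variable may live on its own probability space.\<close>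

definition bounded_in_probability :: "(nat \<Rightarrow> 'w measure) \<Rightarrow> (nat \<Rightarrow> 'w \<Rightarrow> real) \<Rightarrow> bool" where
  "bounded_in_probability M R \<longleftrightarrow>
     (\<forall>n. R n \<in> borel_measurable (M n)) \<and>
     (\<forall>\<epsilon>>0. \<exists>C. \<forall>n. measure (M n) {\<omega> \<in> space (M n). \<bar>R n \<omega>\<bar> > C} \<le> \<epsilon>)"

end

theory Submission
  imports Defs
begin

text \<open>Let \<open>S\<close> and \<open>T\<close> be the parts of communities \<open>k\<^sup>*\<close> and \<open>l\<close> (where \<open>l\<close> maximises
  \<open>B\<^bsub>k\<^sup>*,l\<^esub>\<close>) cut out by two estimated labels. On \<open>S \<times> T\<close> the estimated probability is a
  constant \<open>p\<close>, so off the diagonal the rescaled matrix is \<open>A - p\<close> times a factor at least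
  \<open>2 / sqrt n\<close>, because \<open>p (1 - p) \<le> 1 / 4\<close>. Test it against \<open>x\<close>, the normalised centred
  restriction of \<open>\<psi>\<close> to \<open>S\<close>, and \<open>y\<close>, the normalised restriction of \<open>\<psi>\<close> to \<open>T\<close>. Centring
  kills \<open>p\<close>, and the signal is \<open>B\<^bsub>k\<^sup>*,l\<^esub>\<close> times the deviation of \<open>\<psi>\<close> from its mean on \<open>S\<close>
  times the norm of \<open>\<psi>\<close> on \<open>T\<close>; pigeonholing over the \<open>K\<^sub>0\<close> labels makes both factors large.
  The pair \<open>(x, y)\<close> depends only on \<open>(S, T)\<close>, hence takes at most \<open>4\<^sup>n\<close> values, so Hoeffding's
  inequality and a union bound control the noise term by \<open>O\<^sub>P(sqrt n)\<close> without any estimate of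
  the spectral norm of \<open>A - E A\<close>.\<close>

unbundle no inner_syntax and no vec_syntax

section \<open>The spectral norm as a bound on bilinear forms\<close>

text \<open>The discriminant criterion. The leading coefficient may vanish, so that it also serves
  forms that are only semidefinite; a negative one contradicts the hypothesis.\<close>

lemma square_le_of_quadratic_nonneg:
  fixes a b c :: real
  assumes "\<And>t. a + 2 * t * b + t\<^sup>2 * c \<ge> 0"
  shows "b\<^sup>2 \<le> a * c"
proof -
  have "a \<ge> 0" using assms[of 0] by simp
  consider "c > 0" | "c = 0" | "c < 0" by linarith
  then show ?thesis
  proof cases
    case 1
    \<comment> \<open>The minimiser of the parabola.\<close>
    from assms[of "- b / c"] 1 have "a - b\<^sup>2 / c \<ge> 0"
      by (simp add: power2_eq_square field_simps)
    with 1 show ?thesis by (simp add: field_simps)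
  next
    case 2
    have "b = 0"
    proof (rule ccontr)
      assume "b \<noteq> 0"
      \<comment> \<open>With \<open>c = 0\<close> the polynomial is affine in \<open>t\<close> and
        takes the value \<open>-1\<close> at this point.\<close>
      with assms[of "- (a + 1) / (2 * b)"] 2 show False by (simp add: field_simps)
    qed
    with 2 show ?thesis by simp
  next
    case 3
    \<comment> \<open>Chosen so that \<open>c * t = c - a - 2 * |b| - 1\<close>; after
      multiplication by \<open>t\<close>, which is at least 1, the quadratic term outweighs both
      \<open>a\<close> and \<open>2 * t * b\<close>.\<close>
    define t where "t = (a + 2 * \<bar>b\<bar> + 1) / - c + 1"
    have "t \<ge> 1" using 3 \<open>a \<ge> 0\<close> by (simp add: t_def divide_nonneg_neg)
    have "- c * (t - 1) = a + 2 * \<bar>b\<bar> + 1" using 3 by (simp add: t_def)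
    then have ct: "c * t = c - a - 2 * \<bar>b\<bar> - 1" by (simp add: algebra_simps)
    have "t\<^sup>2 * c = t * (c * t)" by (simp add: power2_eq_square)
    also have "\<dots> = t * c - t * a - 2 * (t * \<bar>b\<bar>) - t" by (simp only: ct) (simp add: algebra_simps)
    finally have "t\<^sup>2 * c = t * c - t * a - 2 * (t * \<bar>b\<bar>) - t" .
    moreover have "t * b \<le> t * \<bar>b\<bar>" using \<open>t \<ge> 1\<close> by (intro mult_left_mono) auto
    moreover have "a \<le> t * a" using \<open>t \<ge> 1\<close> \<open>a \<ge> 0\<close> by (simp add: mult_le_cancel_right1)
    moreover have "t * c < 0" using 3 \<open>t \<ge> 1\<close> by (simp add: mult_pos_neg)
    ultimately have "a + 2 * t * b + t\<^sup>2 * c < 0" using \<open>t \<ge> 1\<close> by linarith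
    with assms[of t] show ?thesis by simp
  qed
qed

lemma scalar_prod_self_nonneg: "(v :: real vec) \<bullet> v \<ge> 0"
  by (simp add: scalar_prod_def sum_nonneg)

lemma scalar_prod_self_eq_0_iff:
  assumes "(v :: real vec) \<in> carrier_vec n"
  shows "v \<bullet> v = 0 \<longleftrightarrow> v = 0\<^sub>v n"
proof
  assume "v \<bullet> v = 0"
  then have "\<forall>i\<in>{0..<dim_vec v}. v $ i * v $ i = 0"
    unfolding scalar_prod_def by (subst sum_nonneg_eq_0_iff[symmetric]) auto
  then show "v = 0\<^sub>v n" using assms by (intro eq_vecI) auto
qed (use assms in auto)

lemma symmetric_scalar_prod_commute:
  fixes H :: "real mat"
  assumes H: "H \<in> carrier_mat n n" and sym: "transpose_mat H = H"
    and u: "u \<in> carrier_vec n" and v: "v \<in> carrier_vec n"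
  shows "v \<bullet> (H *\<^sub>v u) = u \<bullet> (H *\<^sub>v v)"
  using transpose_vec_mult_scalar[OF H u v] sym H u v
    comm_scalar_prod[of "H *\<^sub>v v" n u] by auto

text \<open>The form at \<open>u + t v\<close> is a quadratic in \<open>t\<close> that never becomes
  negative, so its discriminant is bounded. It is applied to \<open>s I - G\<close> and, in the
  guise of the ordinary inequality, to the identity.\<close>

lemma psd_Cauchy_Schwarz:
  fixes H :: "real mat"
  assumes H: "H \<in> carrier_mat n n" and sym: "transpose_mat H = H"
    and psd: "\<And>v. v \<in> carrier_vec n \<Longrightarrow> v \<bullet> (H *\<^sub>v v) \<ge> 0"
    and u: "u \<in> carrier_vec n" and v: "v \<in> carrier_vec n"
  shows "(u \<bullet> (H *\<^sub>v v))\<^sup>2 \<le> (u \<bullet> (H *\<^sub>v u)) * (v \<bullet> (H *\<^sub>v v))"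
proof (rule square_le_of_quadratic_nonneg)
  fix t :: real
  have Hu: "H *\<^sub>v u \<in> carrier_vec n" and Hv: "H *\<^sub>v v \<in> carrier_vec n"
    using H u v by auto
  have "(u + t \<cdot>\<^sub>v v) \<bullet> (H *\<^sub>v (u + t \<cdot>\<^sub>v v))
      = (u + t \<cdot>\<^sub>v v) \<bullet> (H *\<^sub>v u + t \<cdot>\<^sub>v (H *\<^sub>v v))"
    using H u v by (simp add: mult_add_distrib_mat_vec[OF H] mult_mat_vec[OF H])
  also have "\<dots> = u \<bullet> (H *\<^sub>v u) + t * (u \<bullet> (H *\<^sub>v v)) + t * (v \<bullet> (H *\<^sub>v u))
      + t * t * (v \<bullet> (H *\<^sub>v v))"
    using u v Hu Hv
    by (simp add: add_scalar_prod_distrib[of _ n] scalar_prod_add_distrib[of _ n] algebra_simps)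
  also have "v \<bullet> (H *\<^sub>v u) = u \<bullet> (H *\<^sub>v v)"
    by (rule symmetric_scalar_prod_commute[OF H sym u v])
  finally show "u \<bullet> (H *\<^sub>v u) + 2 * t * (u \<bullet> (H *\<^sub>v v)) + t\<^sup>2 * (v \<bullet> (H *\<^sub>v v)) \<ge> 0"
    using psd[of "u + t \<cdot>\<^sub>v v"] u v by (simp add: power2_eq_square algebra_simps)
qed

lemma quadratic_form_bounded:
  fixes G :: "real mat"
  assumes G: "G \<in> carrier_mat n n"
  obtains C where "C > 0" "\<And>v. v \<in> carrier_vec n \<Longrightarrow> v \<bullet> (G *\<^sub>v v) \<le> C * (v \<bullet> v)"
proof
  \<comment> \<open>The summand 1 keeps \<open>C\<close> positive even for a zero matrix; the bound
    for the inverse in \<open>symmetric_top_eigenvalue\<close> is divided by.\<close>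
  define C where "C = (\<Sum>i<n. \<Sum>j<n. \<bar>G $$ (i, j)\<bar>) + 1"
  show "C > 0" unfolding C_def by (intro add_nonneg_pos sum_nonneg) auto
  fix v :: "real vec" assume v: "v \<in> carrier_vec n"
  have le: "(v $ i)\<^sup>2 \<le> v \<bullet> v" if "i < n" for i
    using v that member_le_sum[of i "{0..<n}" "\<lambda>i. v $ i * v $ i"]
    by (simp add: scalar_prod_def power2_eq_square)
  have "v \<bullet> (G *\<^sub>v v) = (\<Sum>i<n. \<Sum>j<n. G $$ (i, j) * (v $ i * v $ j))"
    using v G by (simp add: scalar_prod_def atLeast0LessThan sum_distrib_left mult_ac)
  also have "\<dots> \<le> (\<Sum>i<n. \<Sum>j<n. \<bar>G $$ (i, j)\<bar> * (v \<bullet> v))"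
  proof (intro sum_mono)
    fix i j assume "i \<in> {..<n}" "j \<in> {..<n}"
    then have "\<bar>v $ i * v $ j\<bar> \<le> v \<bullet> v"
      using le[of i] le[of j] sum_squares_bound[of "v $ i" "v $ j"]
        sum_squares_bound[of "v $ i" "- (v $ j)"] by (simp add: abs_if)
    then have "\<bar>G $$ (i, j)\<bar> * \<bar>v $ i * v $ j\<bar> \<le> \<bar>G $$ (i, j)\<bar> * (v \<bullet> v)"
      by (rule mult_left_mono) simp
    then show "G $$ (i, j) * (v $ i * v $ j) \<le> \<bar>G $$ (i, j)\<bar> * (v \<bullet> v)"
      by (metis abs_le_D1 abs_mult)
  qed
  also have "\<dots> \<le> C * (v \<bullet> v)"
    using scalar_prod_self_nonneg[of v]
    by (simp add: C_def algebra_simps sum_distrib_left sum_distrib_right)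
  finally show "v \<bullet> (G *\<^sub>v v) \<le> C * (v \<bullet> v)" .
qed

text \<open>The supremum \<open>s\<close> of the Rayleigh quotient is an eigenvalue: otherwise \<open>H = s I - G\<close> is
  positive semidefinite and invertible, so by the Cauchy--Schwarz inequality for the form of \<open>H\<close>
  it is bounded below by a positive multiple of the identity, and \<open>s\<close> could be decreased.\<close>

lemma symmetric_top_eigenvalue:
  fixes G :: "real mat"
  assumes G: "G \<in> carrier_mat n n" and sym: "transpose_mat G = G" and n: "n > 0"
  obtains s where "eigenvalue G s" "\<And>v. v \<in> carrier_vec n \<Longrightarrow> v \<bullet> (G *\<^sub>v v) \<le> s * (v \<bullet> v)"
proof -
  define R where "R = {v \<bullet> (G *\<^sub>v v) | v. v \<in> carrier_vec n \<and> v \<bullet> v = 1}"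
  define s where "s = Sup R"
  obtain C where C: "\<And>v. v \<in> carrier_vec n \<Longrightarrow> v \<bullet> (G *\<^sub>v v) \<le> C * (v \<bullet> v)"
    using quadratic_form_bounded[OF G] by blast
  have bdd: "bdd_above R" unfolding R_def bdd_above_def using C by fastforce
  have "unit_vec n 0 \<bullet> unit_vec n 0 = (1 :: real)" using n by simp
  then have ne: "R \<noteq> {}" unfolding R_def using unit_vec_carrier by blast
  \<comment> \<open>Bounds on the unit sphere extend to all vectors by homogeneity.\<close>
  have le: "v \<bullet> (G *\<^sub>v v) \<le> r * (v \<bullet> v)"
    if r: "\<And>x. x \<in> R \<Longrightarrow> x \<le> r" and v: "v \<in> carrier_vec n" for v r
  proof (cases "v \<bullet> v = 0")
    case True
    then have "v = 0\<^sub>v n" using scalar_prod_self_eq_0_iff[OF v] by simp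
    then show ?thesis using G by simp
  next
    case False
    define c where "c = 1 / sqrt (v \<bullet> v)"
    have pos: "v \<bullet> v > 0" using False scalar_prod_self_nonneg[of v] by linarith
    have c: "c * c = 1 / (v \<bullet> v)" using pos by (simp add: c_def)
    have "(c \<cdot>\<^sub>v v) \<bullet> (c \<cdot>\<^sub>v v) = 1"
      using v pos c by (simp add: mult.assoc[symmetric])
    moreover have eq: "(c \<cdot>\<^sub>v v) \<bullet> (G *\<^sub>v (c \<cdot>\<^sub>v v)) = (c * c) * (v \<bullet> (G *\<^sub>v v))"
      using v G by (simp add: mult_mat_vec[OF G])
    ultimately have "(c * c) * (v \<bullet> (G *\<^sub>v v)) \<le> r"
      using v by (intro r) (auto simp: R_def intro!: exI[of _ "c \<cdot>\<^sub>v v"])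
    then show ?thesis using pos c by (simp add: field_simps)
  qed
  have ub: "v \<bullet> (G *\<^sub>v v) \<le> s * (v \<bullet> v)" if "v \<in> carrier_vec n" for v
    using that bdd by (intro le) (auto simp: s_def intro: cSup_upper)
  define H where "H = s \<cdot>\<^sub>m 1\<^sub>m n - G"
  have H: "H \<in> carrier_mat n n" using G by (simp add: H_def minus_carrier_mat)
  have G_sym: "G $$ (i, j) = G $$ (j, i)" if "i < n" "j < n" for i j
    using arg_cong[OF sym, of "\<lambda>X. X $$ (i, j)"] G that by simp
  have symH: "transpose_mat H = H"
    using G by (intro eq_matI) (auto simp: H_def G_sym)
  have Hv: "H *\<^sub>v v = s \<cdot>\<^sub>v v - G *\<^sub>v v" if "v \<in> carrier_vec n" for v
  proof -
    have "H *\<^sub>v v = (s \<cdot>\<^sub>m 1\<^sub>m n) *\<^sub>v v - G *\<^sub>v v"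
      unfolding H_def using G that by (intro minus_mult_distrib_mat_vec) auto
    also have "(s \<cdot>\<^sub>m 1\<^sub>m n) *\<^sub>v v = s \<cdot>\<^sub>v v"
      using that by (intro eq_vecI) auto
    finally show ?thesis .
  qed
  have qH: "v \<bullet> (H *\<^sub>v v) = s * (v \<bullet> v) - v \<bullet> (G *\<^sub>v v)" if "v \<in> carrier_vec n" for v
    using that G by (simp add: Hv scalar_prod_minus_distrib[of _ n])
  have psd: "v \<bullet> (H *\<^sub>v v) \<ge> 0" if "v \<in> carrier_vec n" for v
    using that ub[of v] by (simp add: qH)
  have "det H = 0"
  proof (rule ccontr)
    assume "det H \<noteq> 0"
    from det_non_zero_imp_unit[OF H this, of "()"]
    obtain W where W: "W \<in> carrier_mat n n" and inv: "H * W = 1\<^sub>m n"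
      unfolding Units_def by (auto simp: ring_mat_def)
    obtain c where c: "c > 0" "\<And>v. v \<in> carrier_vec n \<Longrightarrow> v \<bullet> (W *\<^sub>v v) \<le> c * (v \<bullet> v)"
      using quadratic_form_bounded[OF W] by blast
    \<comment> \<open>The second vector in the Cauchy-Schwarz inequality is \<open>W v\<close>, with
      \<open>W\<close> the inverse of \<open>H\<close>: since \<open>H (W v) = v\<close>, it reads
      \<open>1 \<le> (v . H v) (v . W v) \<le> (v . H v) c\<close> for a unit vector, which bounds
      \<open>H\<close> below by \<open>1 / c\<close>.\<close>
    have "x \<le> s - 1 / c" if "x \<in> R" for x
    proof -
      from that obtain v where v: "v \<in> carrier_vec n" and v1: "v \<bullet> v = 1"
        and x: "x = v \<bullet> (G *\<^sub>v v)" unfolding R_def by blast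
      have Wv: "W *\<^sub>v v \<in> carrier_vec n" using W v by simp
      have HWv: "H *\<^sub>v (W *\<^sub>v v) = v"
        using assoc_mult_mat_vec[OF H W v] inv v by simp
      have "v \<bullet> (H *\<^sub>v (W *\<^sub>v v)) = 1" using HWv v1 by simp
      then have "1 \<le> (v \<bullet> (H *\<^sub>v v)) * ((W *\<^sub>v v) \<bullet> v)"
        using psd_Cauchy_Schwarz[OF H symH psd v Wv] HWv by simp
      also have "(W *\<^sub>v v) \<bullet> v = v \<bullet> (W *\<^sub>v v)" by (rule comm_scalar_prod[OF Wv v])
      also have "(v \<bullet> (H *\<^sub>v v)) * \<dots> \<le> (v \<bullet> (H *\<^sub>v v)) * c"
        using c(2)[OF v] v1 psd[OF v] by (intro mult_left_mono) auto
      finally show ?thesis using c(1) v1 by (simp add: qH[OF v] x field_simps)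
    qed
    then have "s \<le> s - 1 / c" unfolding s_def using ne by (intro cSup_least) (auto simp: s_def)
    with c(1) show False by (simp add: field_simps)
  qed
  then obtain v where v: "v \<in> carrier_vec n" "v \<noteq> 0\<^sub>v n" "H *\<^sub>v v = 0\<^sub>v n"
    using det_0_iff_vec_prod_zero[OF H] by blast
  have "G *\<^sub>v v = s \<cdot>\<^sub>v v"
  proof (rule eq_vecI)
    fix i assume "i < dim_vec (s \<cdot>\<^sub>v v)"
    then show "(G *\<^sub>v v) $ i = (s \<cdot>\<^sub>v v) $ i"
      using arg_cong[OF v(3), of "\<lambda>w. w $ i"] v(1) G by (simp add: Hv[OF v(1)])
  qed (use v G in auto)
  then have "eigenvalue G s"
    unfolding eigenvalue_def eigenvector_def using v G by (intro exI[of _ v]) auto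
  with ub that show ?thesis by blast
qed

text \<open>Makes the \<open>Max\<close> in \<open>spectral_norm\<close> meaningful. The squares of
  singular values are roots of a monic, hence nonzero, characteristic polynomial.\<close>

lemma finite_singular_values:
  assumes X: "X \<in> carrier_mat n n"
  shows "finite (singular_values X)"
proof -
  have G: "transpose_mat X * X \<in> carrier_mat n n" using X by simp
  have "char_poly (transpose_mat X * X) \<noteq> 0"
    using degree_monic_char_poly[OF G] by auto
  then have "finite {r. eigenvalue (transpose_mat X * X) r}"
    unfolding eigenvalue_root_char_poly[OF G] by (rule poly_roots_finite)
  then have "finite (sqrt ` {r. eigenvalue (transpose_mat X * X) r})" by simp
  moreover have "singular_values X \<subseteq> sqrt ` {r. eigenvalue (transpose_mat X * X) r}"
    unfolding singular_values_def by (force intro!: image_eqI[where x = "_\<^sup>2"])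
  ultimately show ?thesis by (rule finite_subset[rotated])
qed

lemma spectral_norm_ge_bilinear:
  fixes X :: "real mat" and x y :: "real vec"
  assumes X: "X \<in> carrier_mat n n" and n: "n > 0"
    and x: "x \<in> carrier_vec n" "x \<bullet> x \<le> 1" and y: "y \<in> carrier_vec n" "y \<bullet> y \<le> 1"
  shows "x \<bullet> (X *\<^sub>v y) \<le> spectral_norm X"
proof -
  define G where "G = transpose_mat X * X"
  have G: "G \<in> carrier_mat n n" using X by (simp add: G_def)
  have symG: "transpose_mat G = G"
    using X by (simp add: G_def transpose_mult[of "transpose_mat X" n n X n])
  have qG: "v \<bullet> (G *\<^sub>v v) = (X *\<^sub>v v) \<bullet> (X *\<^sub>v v)" if v: "v \<in> carrier_vec n" for v
  proof -
    have "v \<bullet> (G *\<^sub>v v) = (G *\<^sub>v v) \<bullet> v"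
      using G v by (intro comm_scalar_prod[of _ n]) auto
    also have "\<dots> = (transpose_mat X *\<^sub>v (X *\<^sub>v v)) \<bullet> v"
      unfolding G_def using X v by (subst assoc_mult_mat_vec[of _ n n _ n]) auto
    also have "\<dots> = (X *\<^sub>v v) \<bullet> (X *\<^sub>v v)"
      using X v by (intro transpose_vec_mult_scalar) auto
    finally show ?thesis .
  qed
  obtain s where ev: "eigenvalue G s"
    and ub: "\<And>v. v \<in> carrier_vec n \<Longrightarrow> v \<bullet> (G *\<^sub>v v) \<le> s * (v \<bullet> v)"
    using symmetric_top_eigenvalue[OF G symG n] by blast
  have s: "s \<ge> 0"
    using ub[of "unit_vec n 0"] qG[of "unit_vec n 0"] scalar_prod_self_nonneg[of "X *\<^sub>v unit_vec n 0"] n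
    by simp
  have "sqrt s \<in> singular_values X"
    using ev s by (simp add: singular_values_def G_def)
  then have norm: "sqrt s \<le> spectral_norm X"
    unfolding spectral_norm_def using finite_singular_values[OF X] by (rule Max_ge[rotated])
  have Xy: "X *\<^sub>v y \<in> carrier_vec n" using X y by simp
  \<comment> \<open>The ordinary Cauchy-Schwarz inequality, as the case of the identity
    matrix.\<close>
  have "(x \<bullet> (1\<^sub>m n *\<^sub>v (X *\<^sub>v y)))\<^sup>2
      \<le> (x \<bullet> (1\<^sub>m n *\<^sub>v x)) * ((X *\<^sub>v y) \<bullet> (1\<^sub>m n *\<^sub>v (X *\<^sub>v y)))"
    using x Xy by (intro psd_Cauchy_Schwarz) (auto simp: scalar_prod_self_nonneg)
  then have "(x \<bullet> (X *\<^sub>v y))\<^sup>2 \<le> (x \<bullet> x) * ((X *\<^sub>v y) \<bullet> (X *\<^sub>v y))"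
    using x Xy by simp
  also have "\<dots> \<le> 1 * s"
  proof (rule mult_mono)
    have "s * (y \<bullet> y) \<le> s" using y s by (simp add: mult_left_le)
    with ub[OF y(1)] show "(X *\<^sub>v y) \<bullet> (X *\<^sub>v y) \<le> s" by (simp add: qG[OF y(1)])
  qed (use x scalar_prod_self_nonneg in auto)
  finally have "x \<bullet> (X *\<^sub>v y) \<le> sqrt s" by (simp add: real_le_rsqrt)
  with norm show ?thesis by simp
qed

section \<open>Concentration of bilinear forms of the noise\<close>

text \<open>The variable \<open>c i * X i\<close> ranges over an interval of length
  \<open>|c i|\<close>, so the Hoeffding exponent is \<open>-2 * t^2\<close> divided by the sum of
  squared weights. The bound 2 on that sum is the one provided by
  \<open>sum_upper_square_le\<close>.\<close>

lemma indep_vars_Hoeffding_abs: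
  fixes X :: "'i \<Rightarrow> 'a \<Rightarrow> real" and c :: "'i \<Rightarrow> real"
  assumes M: "prob_space M" and fin: "finite I"
    and indep: "prob_space.indep_vars M (\<lambda>_. borel) X I"
    and X01: "\<And>i \<omega>. i \<in> I \<Longrightarrow> \<omega> \<in> space M \<Longrightarrow> X i \<omega> \<in> {0..1}"
    and mean: "\<And>i. i \<in> I \<Longrightarrow> integral\<^sup>L M (X i) = p i"
    and c2: "(\<Sum>i\<in>I. (c i)\<^sup>2) \<le> 2" and t: "t > 0"
  shows "measure M {\<omega> \<in> space M. \<bar>\<Sum>i\<in>I. c i * (X i \<omega> - p i)\<bar> \<ge> t} \<le> 2 * exp (- t\<^sup>2)"
proof (cases "(\<Sum>i\<in>I. (c i)\<^sup>2) = 0")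
  \<comment> \<open>Zero weights are treated apart, since the exponent would divide by zero.\<close>
  case True
  then have "\<forall>i\<in>I. c i = 0" using fin by (subst (asm) sum_nonneg_eq_0_iff) auto
  then show ?thesis using t by simp
next
  case False
  interpret prob_space M by (fact M)
  define Y where "Y = (\<lambda>i \<omega>. c i * X i \<omega>)"
  have rv: "random_variable borel (X i)" if "i \<in> I" for i
    using indep that unfolding indep_vars_def by blast
  have int: "integrable M (X i)" if "i \<in> I" for i
    using rv[OF that] X01[OF that] by (intro integrable_const_bound[where B = 1]) auto
  have mem: "c * x \<in> {min 0 c..max 0 c}" if "x \<in> {0..1}" for c x :: real
  proof (cases "c \<ge> 0")
    case True
    with that show ?thesis by (auto simp: mult_left_le)
  next
    case False
    with that show ?thesis
      using mult_left_le[of x "- c"] by (auto simp: mult_nonpos_nonneg min_def max_def)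
  qed
  interpret Hoeffding_ineq M I Y "\<lambda>i. min 0 (c i)" "\<lambda>i. max 0 (c i)" "\<Sum>i\<in>I. expectation (Y i)"
  proof unfold_locales
    show "indep_vars (\<lambda>_. borel) Y I"
      unfolding Y_def by (rule indep_vars_compose2[OF indep]) auto
    show "AE x in M. Y i x \<in> {min 0 (c i)..max 0 (c i)}" if "i \<in> I" for i
      unfolding Y_def using X01[OF that] by (intro AE_I2 mem) auto
  qed (use fin in auto)
  have len: "(\<Sum>i\<in>I. (max 0 (c i) - min 0 (c i))\<^sup>2) = (\<Sum>i\<in>I. (c i)\<^sup>2)"
    by (intro sum.cong) (auto simp: max_def min_def)
  have pos: "(\<Sum>i\<in>I. (c i)\<^sup>2) > 0"
    using False by (simp add: order.not_eq_order_implies_strict sum_nonneg)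
  have EY: "(\<Sum>i\<in>I. expectation (Y i)) = (\<Sum>i\<in>I. c i * p i)"
    using mean by (simp add: Y_def)
  have "measure M {\<omega> \<in> space M. \<bar>\<Sum>i\<in>I. c i * (X i \<omega> - p i)\<bar> \<ge> t}
      = measure M {\<omega> \<in> space M. \<bar>(\<Sum>i\<in>I. Y i \<omega>) - (\<Sum>i\<in>I. expectation (Y i))\<bar> \<ge> t}"
    unfolding EY by (simp add: Y_def algebra_simps sum_subtractf)
  also have "\<dots> \<le> 2 * exp (- 2 * t\<^sup>2 / (\<Sum>i\<in>I. (c i)\<^sup>2))"
    using Hoeffding_ineq_abs_ge[of t] t pos by (simp add: len)
  also have "\<dots> \<le> 2 * exp (- t\<^sup>2)"
    using pos c2 t by (simp add: field_simps)
  finally show ?thesis .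
qed

text \<open>Independence is available only above the diagonal, so the two orders of each pair of
  nodes are collected into one term.\<close>

lemma sum_offdiag_eq_sum_upper:
  fixes f :: "nat \<Rightarrow> nat \<Rightarrow> real"
  shows "(\<Sum>i<n. \<Sum>j\<in>{..<n} - {i}. f i j) = (\<Sum>(i, j)\<in>{(i, j). i < j \<and> j < n}. f i j + f j i)"
proof -
  let ?U = "{(i, j). i < j \<and> j < n}" and ?L = "{(i, j). j < i \<and> i < n}"
  have fin: "finite ?U" "finite ?L"
    by (rule finite_subset[of _ "{..<n} \<times> {..<n}"]; force)+
  have "(\<Sum>i<n. \<Sum>j\<in>{..<n} - {i}. f i j) = (\<Sum>(i, j)\<in>Sigma {..<n} (\<lambda>i. {..<n} - {i}). f i j)"
    by (rule sum.Sigma) auto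
  also have "Sigma {..<n} (\<lambda>i. {..<n} - {i}) = ?U \<union> ?L" by auto
  also have "(\<Sum>(i, j)\<in>?U \<union> ?L. f i j) = (\<Sum>(i, j)\<in>?U. f i j) + (\<Sum>(i, j)\<in>?L. f i j)"
    using fin by (intro sum.union_disjoint) auto
  also have "(\<Sum>(i, j)\<in>?L. f i j) = (\<Sum>(i, j)\<in>?U. f j i)"
    by (rule sum.reindex_bij_witness[where i = prod.swap and j = prod.swap]) auto
  finally show ?thesis by (simp add: sum.distrib case_prod_unfold)
qed

text \<open>Leaving out the diagonal matters: with \<open>P\<close> the mean matrix the form is then
  centred, whereas on the diagonal \<open>a\<close> vanishes and \<open>P i i\<close> may be
  positive.\<close>

definition noise_form ::
    "nat \<Rightarrow> (nat \<Rightarrow> nat \<Rightarrow> real) \<Rightarrow> (nat \<Rightarrow> real) \<Rightarrow> (nat \<Rightarrow> real) \<Rightarrow> real mat \<Rightarrow> real" where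
  "noise_form n P x y a = (\<Sum>i<n. \<Sum>j\<in>{..<n} - {i}. x i * (a $$ (i, j) - P i j) * y j)"

definition dcbm_mean :: "(nat \<Rightarrow> nat) \<Rightarrow> (nat \<Rightarrow> nat \<Rightarrow> real) \<Rightarrow> (nat \<Rightarrow> real) \<Rightarrow> nat \<Rightarrow> nat \<Rightarrow> real" where
  "dcbm_mean g B \<psi> i j = \<psi> i * \<psi> j * B (g i) (g j)"

lemma noise_form_eq_sum_upper:
  assumes a: "a \<in> adjacency_matrices n" and B: "sbm_parameters n K g B"
  shows "noise_form n (dcbm_mean g B \<psi>) x y a
    = (\<Sum>(i, j)\<in>{(i, j). i < j \<and> j < n}.
        (x i * y j + x j * y i) * (a $$ (i, j) - dcbm_mean g B \<psi> i j))"
  unfolding noise_form_def sum_offdiag_eq_sum_upper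
proof (intro sum.cong refl, clarify)
  fix i j assume "i < j" "j < n"
  then have "a $$ (j, i) = a $$ (i, j)" "dcbm_mean g B \<psi> j i = dcbm_mean g B \<psi> i j"
    using a B by (auto simp: adjacency_matrices_def sbm_parameters_def dcbm_mean_def)
  then show "x i * (a $$ (i, j) - dcbm_mean g B \<psi> i j) * y j
      + x j * (a $$ (j, i) - dcbm_mean g B \<psi> j i) * y i
      = (x i * y j + x j * y i) * (a $$ (i, j) - dcbm_mean g B \<psi> i j)"
    by (simp add: algebra_simps)
qed

text \<open>By \<open>(a + b)^2 \<le> 2 a^2 + 2 b^2\<close> the sum is at most twice a sum over
  ordered pairs, which factorises after the diagonal is added.\<close>

lemma sum_upper_square_le:
  fixes x y :: "nat \<Rightarrow> real"
  assumes x: "(\<Sum>i<n. (x i)\<^sup>2) \<le> 1" and y: "(\<Sum>i<n. (y i)\<^sup>2) \<le> 1"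
  shows "(\<Sum>(i, j)\<in>{(i, j). i < j \<and> j < n}. (x i * y j + x j * y i)\<^sup>2) \<le> 2"
proof -
  have "(\<Sum>(i, j)\<in>{(i, j). i < j \<and> j < n}. (x i * y j + x j * y i)\<^sup>2)
      \<le> (\<Sum>(i, j)\<in>{(i, j). i < j \<and> j < n}. 2 * (x i * y j)\<^sup>2 + 2 * (x j * y i)\<^sup>2)"
  proof (intro sum_mono, clarify)
    fix i j
    show "(x i * y j + x j * y i)\<^sup>2 \<le> 2 * (x i * y j)\<^sup>2 + 2 * (x j * y i)\<^sup>2"
      using sum_squares_bound[of "x i * y j" "x j * y i"]
      by (simp add: power2_sum)
  qed
  also have "\<dots> = (\<Sum>i<n. \<Sum>j\<in>{..<n} - {i}. 2 * (x i * y j)\<^sup>2)"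
    by (rule sum_offdiag_eq_sum_upper[symmetric])
  also have "\<dots> \<le> (\<Sum>i<n. \<Sum>j<n. 2 * (x i * y j)\<^sup>2)"
    by (intro sum_mono sum_mono2) auto
  also have "\<dots> = 2 * ((\<Sum>i<n. (x i)\<^sup>2) * (\<Sum>j<n. (y j)\<^sup>2))"
    by (subst sum_product) (simp only: sum_distrib_left power_mult_distrib)
  also have "\<dots> \<le> 2 * (1 * 1)"
    using x y by (intro mult_left_mono mult_mono sum_nonneg) auto
  finally show ?thesis by simp
qed

section \<open>Mean, measurability and tail of the noise under the block model\<close>

lemma dcbm_entry_measurable:
  assumes "dcbm M n K g B \<psi> A" "i < j" "j < n"
  shows "(\<lambda>\<omega>. A \<omega> $$ (i, j)) \<in> borel_measurable M"
proof -
  interpret prob_space M using assms by (simp add: dcbm_def)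
  have "indep_vars (\<lambda>_. borel) (\<lambda>(i, j) \<omega>. A \<omega> $$ (i, j)) {(i, j). i < j \<and> j < n}"
    using assms(1) by (simp add: dcbm_def)
  then have "\<forall>p\<in>{(i, j). i < j \<and> j < n}. random_variable borel ((\<lambda>(i, j) \<omega>. A \<omega> $$ (i, j)) p)"
    unfolding indep_vars_def by blast
  from bspec[OF this, of "(i, j)"] assms show ?thesis by simp
qed

lemma dcbm_expectation:
  assumes D: "dcbm M n K g B \<psi> A" and ij: "i < j" "j < n"
  shows "integral\<^sup>L M (\<lambda>\<omega>. A \<omega> $$ (i, j)) = dcbm_mean g B \<psi> i j"
proof -
  interpret prob_space M using D by (simp add: dcbm_def)
  let ?E = "{\<omega> \<in> space M. A \<omega> $$ (i, j) = 1}"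
  have [measurable]: "(\<lambda>\<omega>. A \<omega> $$ (i, j)) \<in> borel_measurable M"
    by (rule dcbm_entry_measurable[OF D ij])
  have "A \<omega> $$ (i, j) = indicator ?E \<omega>" if "\<omega> \<in> space M" for \<omega>
  proof -
    have "A \<omega> \<in> adjacency_matrices n" using D that by (simp add: dcbm_def)
    then have "\<forall>i<n. \<forall>j<n. A \<omega> $$ (i, j) \<in> {0, 1}" unfolding adjacency_matrices_def by blast
    moreover have "i < n" using ij by simp
    ultimately have "A \<omega> $$ (i, j) \<in> {0, 1}" using ij by blast
    then show ?thesis using that by (auto simp: indicator_def)
  qed
  then have "integral\<^sup>L M (\<lambda>\<omega>. A \<omega> $$ (i, j)) = integral\<^sup>L M (indicator ?E)"
    by (rule Bochner_Integration.integral_cong[OF refl])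
  also have "\<dots> = measure M ?E" by simp
  also have "\<dots> = dcbm_mean g B \<psi> i j" using D ij by (auto simp: dcbm_def dcbm_mean_def)
  finally show ?thesis .
qed

lemma noise_form_measurable:
  assumes D: "dcbm M n K g B \<psi> A"
  shows "(\<lambda>\<omega>. noise_form n (dcbm_mean g B \<psi>) x y (A \<omega>)) \<in> borel_measurable M"
proof -
  have "(\<lambda>\<omega>. \<Sum>(i, j)\<in>{(i, j). i < j \<and> j < n}.
        (x i * y j + x j * y i) * (A \<omega> $$ (i, j) - dcbm_mean g B \<psi> i j)) \<in> borel_measurable M"
  proof (rule borel_measurable_sum)
    fix p assume "p \<in> {(i, j). i < j \<and> j < n}"
    then obtain i j where [simp]: "p = (i, j)" and ij: "i < j" "j < n" by auto
    note [measurable] = dcbm_entry_measurable[OF D ij]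
    show "(\<lambda>\<omega>. case p of (i, j) \<Rightarrow>
        (x i * y j + x j * y i) * (A \<omega> $$ (i, j) - dcbm_mean g B \<psi> i j)) \<in> borel_measurable M"
      by simp
  qed
  moreover have "noise_form n (dcbm_mean g B \<psi>) x y (A \<omega>) = (\<Sum>(i, j)\<in>{(i, j). i < j \<and> j < n}.
      (x i * y j + x j * y i) * (A \<omega> $$ (i, j) - dcbm_mean g B \<psi> i j))" if "\<omega> \<in> space M" for \<omega>
    using D that by (intro noise_form_eq_sum_upper) (auto simp: dcbm_def)
  ultimately show ?thesis by (simp cong: measurable_cong)
qed

lemma noise_form_tail:
  assumes D: "dcbm M n K g B \<psi> A" and t: "t > 0"
    and x: "(\<Sum>i<n. (x i)\<^sup>2) \<le> 1" and y: "(\<Sum>i<n. (y i)\<^sup>2) \<le> 1"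
  shows "measure M {\<omega> \<in> space M. \<bar>noise_form n (dcbm_mean g B \<psi>) x y (A \<omega>)\<bar> \<ge> t} \<le> 2 * exp (- t\<^sup>2)"
proof -
  let ?U = "{(i, j). i < j \<and> j < n}"
  let ?X = "\<lambda>(i, j) \<omega>. A \<omega> $$ (i, j)"
  let ?c = "\<lambda>(i, j). x i * y j + x j * y i"
  let ?p = "\<lambda>(i, j). dcbm_mean g B \<psi> i j"
  have adj: "A \<omega> \<in> adjacency_matrices n" if "\<omega> \<in> space M" for \<omega>
    using D that by (simp add: dcbm_def)
  have B: "sbm_parameters n K g B" using D by (simp add: dcbm_def)
  have "noise_form n (dcbm_mean g B \<psi>) x y (A \<omega>) = (\<Sum>q\<in>?U. ?c q * (?X q \<omega> - ?p q))"
    if "\<omega> \<in> space M" for \<omega>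
    unfolding noise_form_eq_sum_upper[OF adj[OF that] B] by (simp only: case_prod_unfold)
  then have "{\<omega> \<in> space M. \<bar>noise_form n (dcbm_mean g B \<psi>) x y (A \<omega>)\<bar> \<ge> t}
      = {\<omega> \<in> space M. \<bar>\<Sum>q\<in>?U. ?c q * (?X q \<omega> - ?p q)\<bar> \<ge> t}"
    by (intro Collect_cong conj_cong refl) simp
  also have "measure M \<dots> \<le> 2 * exp (- t\<^sup>2)"
  proof (rule indep_vars_Hoeffding_abs)
    show "finite ?U" by (rule finite_subset[of _ "{..<n} \<times> {..<n}"]) auto
    show "prob_space M" "prob_space.indep_vars M (\<lambda>_. borel) ?X ?U"
      using D unfolding dcbm_def by blast+
    show "?X q \<omega> \<in> {0..1}" if q: "q \<in> ?U" and \<omega>: "\<omega> \<in> space M" for q \<omega>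
    proof -
      obtain i j where [simp]: "q = (i, j)" and ij: "i < n" "j < n" using q by (cases q) auto
      have "\<forall>i<n. \<forall>j<n. A \<omega> $$ (i, j) \<in> {0, 1}"
        using adj[OF \<omega>] unfolding adjacency_matrices_def by blast
      with ij have "A \<omega> $$ (i, j) \<in> {0, 1}" by blast
      then show ?thesis by auto
    qed
    show "integral\<^sup>L M (?X q) = ?p q" if "q \<in> ?U" for q
    proof (cases q)
      case (Pair i j)
      with that show ?thesis using dcbm_expectation[OF D, of i j] by simp
    qed
    show "(\<Sum>q\<in>?U. (?c q)\<^sup>2) \<le> 2"
      using sum_upper_square_le[OF x y] by (simp add: case_prod_unfold)
  qed (fact t)
  finally show ?thesis .
qed

text \<open>The pair of sets used later depends on the data through the estimated labels, so the
  maximum runs over all pairs. The factor \<open>2 / sqrt n\<close> is the rescaling of the matrix,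
  and the summand 1 is the cost of the missing diagonal in
  \<open>offdiag_rank_one_ge\<close>.\<close>

lemma bounded_in_probability_of_noise_max:
  fixes A :: "nat \<Rightarrow> 'w \<Rightarrow> real mat" and u v :: "nat \<Rightarrow> nat set \<Rightarrow> nat \<Rightarrow> real"
  assumes D: "\<And>n. dcbm (M n) n (K n) (g n) (B n) (\<psi> n) (A n)"
    and u: "\<And>n S. (\<Sum>i<n. (u n S i)\<^sup>2) \<le> 1" and v: "\<And>n S. (\<Sum>i<n. (v n S i)\<^sup>2) \<le> 1"
  shows "bounded_in_probability M (\<lambda>n \<omega>. - (2 / sqrt (real n)) *
    (Max ((\<lambda>(S, T). \<bar>noise_form n (dcbm_mean (g n) (B n) (\<psi> n)) (u n S) (v n T) (A n \<omega>)\<bar>)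
       ` (Pow {..<n} \<times> Pow {..<n})) + 1))"
proof -
  define Z where "Z = (\<lambda>n q \<omega>. case q of (S, T) \<Rightarrow>
    \<bar>noise_form n (dcbm_mean (g n) (B n) (\<psi> n)) (u n S) (v n T) (A n \<omega>)\<bar>)"
  define I where "I = (\<lambda>n. Pow {..<n::nat} \<times> Pow {..<n})"
  define R where "R = (\<lambda>n \<omega>. - (2 / sqrt (real n)) * (Max ((\<lambda>q. Z n q \<omega>) ` I n) + 1))"
  have fin: "finite (I n)" and ne: "I n \<noteq> {}" for n by (auto simp: I_def)
  have Z[measurable]: "Z n q \<in> borel_measurable (M n)" for n q
  proof (cases q)
    case (Pair S T)
    then show ?thesis
      using borel_measurable_abs[OF noise_form_measurable[OF D[of n], of "u n S" "v n T"]]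
      by (simp add: Z_def)
  qed
  have Z_tail: "measure (M n) {\<omega> \<in> space (M n). Z n q \<omega> \<ge> t} \<le> 2 * exp (- t\<^sup>2)"
    if "t > 0" for n q t
    using noise_form_tail[OF D[of n] that u[of n "fst q"] v[of n "snd q"]]
    by (simp add: Z_def case_prod_unfold)
  have "bounded_in_probability M R"
    unfolding bounded_in_probability_def
  proof (intro conjI allI impI)
    show "R n \<in> borel_measurable (M n)" for n
      unfolding R_def
      by (intro borel_measurable_times borel_measurable_add borel_measurable_const
          borel_measurable_Max fin Z)
    fix \<epsilon> :: real assume \<epsilon>: "\<epsilon> > 0"
    \<comment> \<open>From \<open>c \<ge> 2\<close> follows \<open>c * c - 2 \<ge> c\<close>, so at
      level \<open>t = c * sqrt n\<close> the exponent \<open>2 n - t^2\<close> is at most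
      \<open>-c\<close>; the second entry turns \<open>2 * exp (- c)\<close> into at most
      \<open>\<epsilon>\<close>.\<close>
    define c where "c = max 2 (ln (2 / \<epsilon>))"
    have c2: "c \<ge> 2" by (simp add: c_def)
    have "measure (M n) {\<omega> \<in> space (M n). \<bar>R n \<omega>\<bar> > 2 * (c + 1)} \<le> \<epsilon>" for n
    proof (cases "n = 0")
      \<comment> \<open>For \<open>n = 0\<close> division by zero makes the variable vanish.\<close>
      case True
      then show ?thesis using \<epsilon> c2 by (simp add: R_def)
    next
      case False
      interpret prob_space "M n" using D[of n] by (simp add: dcbm_def)
      define t where "t = c * sqrt (real n)"
      have n1: "real n \<ge> 1" using False by simp
      have t0: "t > 0" using c2 n1 by (simp add: t_def)
      \<comment> \<open>Exceeding \<open>2 * (c + 1)\<close> means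
        \<open>Z + 1 > (c + 1) * sqrt n\<close> for the maximising pair, and
        \<open>sqrt n \<ge> 1\<close> absorbs the added 1.\<close>
      have "\<exists>q\<in>I n. Z n q \<omega> \<ge> t" if gt: "2 * (c + 1) < \<bar>R n \<omega>\<bar>" for \<omega>
      proof -
        have "Max ((\<lambda>q. Z n q \<omega>) ` I n) \<in> (\<lambda>q. Z n q \<omega>) ` I n"
          using fin ne by (intro Max_in) auto
        then obtain q where q: "q \<in> I n" "Max ((\<lambda>q. Z n q \<omega>) ` I n) = Z n q \<omega>" by auto
        have m0: "Z n q \<omega> \<ge> 0" by (simp add: Z_def case_prod_unfold)
        have "\<bar>R n \<omega>\<bar> = 2 / sqrt (real n) * (Z n q \<omega> + 1)"
          using m0 by (simp add: R_def q(2) abs_mult)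
        with gt have "(c + 1) * sqrt (real n) < Z n q \<omega> + 1" using n1 by (simp add: field_simps)
        moreover have "sqrt (real n) \<ge> 1" using n1 by simp
        ultimately have "Z n q \<omega> \<ge> t" unfolding t_def distrib_right by linarith
        with q(1) show ?thesis by blast
      qed
      then have "{\<omega> \<in> space (M n). \<bar>R n \<omega>\<bar> > 2 * (c + 1)}
          \<subseteq> (\<Union>q\<in>I n. {\<omega> \<in> space (M n). Z n q \<omega> \<ge> t})"
        by blast
      then have "measure (M n) {\<omega> \<in> space (M n). \<bar>R n \<omega>\<bar> > 2 * (c + 1)}
          \<le> measure (M n) (\<Union>q\<in>I n. {\<omega> \<in> space (M n). Z n q \<omega> \<ge> t})"
        using fin by (intro finite_measure_mono) auto
      also have "\<dots> \<le> (\<Sum>q\<in>I n. measure (M n) {\<omega> \<in> space (M n). Z n q \<omega> \<ge> t})"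
        using fin by (intro finite_measure_subadditive_finite) auto
      also have "\<dots> \<le> (\<Sum>q\<in>I n. 2 * exp (- t\<^sup>2))"
        by (intro sum_mono Z_tail t0)
      \<comment> \<open>There are \<open>4^n\<close> pairs; \<open>2 \<le> exp 1\<close> then gives
        the factor \<open>exp (2 n)\<close>.\<close>
      also have "\<dots> = (2 * 2) ^ n * (2 * exp (- t\<^sup>2))"
        unfolding power_mult_distrib by (simp add: I_def card_cartesian_product card_Pow)
      also have "\<dots> \<le> exp (2 * real n) * (2 * exp (- t\<^sup>2))"
      proof (rule mult_right_mono)
        have "(2::real) \<le> exp 1" using exp_ge_add_one_self[of "1::real"] by simp
        then have "(2 * 2 :: real) ^ n \<le> (exp 1 * exp 1) ^ n"
          by (intro power_mono mult_mono) auto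
        also have "\<dots> = exp (2 * real n)"
          by (simp add: mult.commute flip: exp_add exp_of_nat_mult)
        finally show "(2 * 2 :: real) ^ n \<le> exp (2 * real n)" .
      qed simp
      also have "\<dots> = 2 * exp (2 * real n - t\<^sup>2)"
        by (simp add: exp_diff exp_minus divide_inverse)
      also have "\<dots> \<le> 2 * exp (- ln (2 / \<epsilon>))"
      proof -
        have "c * 2 \<le> c * c" using c2 by (intro mult_left_mono) auto
        then have "c \<le> c * c - 2" using c2 by linarith
        then have "c * 1 \<le> (c * c - 2) * real n"
          using c2 n1 by (intro mult_mono) linarith+
        moreover have "t\<^sup>2 = c * c * real n"
          by (simp add: t_def power_mult_distrib power2_eq_square)
        moreover have "ln (2 / \<epsilon>) \<le> c" by (simp add: c_def)
        ultimately show ?thesis by (simp add: algebra_simps)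
      qed
      also have "\<dots> = \<epsilon>" using \<epsilon> by (simp add: exp_minus)
      finally show ?thesis .
    qed
    then show "\<exists>C. \<forall>n. measure (M n) {\<omega> \<in> space (M n). \<bar>R n \<omega>\<bar> > C} \<le> \<epsilon>" by blast
  qed
  then show ?thesis by (simp add: R_def Z_def I_def case_prod_unfold)
qed

section \<open>Normalised and centred test vectors\<close>

text \<open>The extension by zero outside \<open>S\<close> lets sums over a block be written as sums
  over all nodes. If the norm on \<open>S\<close> is zero, division by zero makes the whole vector
  zero.\<close>

definition normalized_on :: "(nat \<Rightarrow> real) \<Rightarrow> nat set \<Rightarrow> nat \<Rightarrow> real" where
  "normalized_on v S i = (if i \<in> S then v i / L2_set v S else 0)"

definition set_mean :: "(nat \<Rightarrow> real) \<Rightarrow> nat set \<Rightarrow> real" where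
  "set_mean v S = (\<Sum>i\<in>S. v i) / real (card S)"

definition centered_on :: "(nat \<Rightarrow> real) \<Rightarrow> nat set \<Rightarrow> nat \<Rightarrow> real" where
  "centered_on v S i = v i - set_mean v S"

lemma L2_set_square: "(L2_set v S)\<^sup>2 = (\<Sum>i\<in>S. (v i)\<^sup>2)"
  by (simp add: L2_set_def sum_nonneg)

lemma sum_normalized_on_square_le: "(\<Sum>i<n. (normalized_on v S i)\<^sup>2) \<le> 1"
\<comment> \<open>An infinite \<open>S\<close> also falls under the first case, because its sum of
  squares is 0 by convention; the bound thus holds for every \<open>S\<close>.\<close>
proof (cases "L2_set v S = 0")
  case True
  then have "normalized_on v S i = 0" for i by (simp add: normalized_on_def)
  then show ?thesis by simp
next
  case False
  then have fin: "finite S" by (rule contrapos_np) simp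
  have "(\<Sum>i<n. (normalized_on v S i)\<^sup>2) \<le> (\<Sum>i\<in>{..<n} \<union> S. (normalized_on v S i)\<^sup>2)"
    using fin by (intro sum_mono2) auto
  also have "\<dots> = (\<Sum>i\<in>S. (normalized_on v S i)\<^sup>2)"
    using fin by (intro sum.mono_neutral_right) (auto simp: normalized_on_def)
  also have "\<dots> = (\<Sum>i\<in>S. (v i)\<^sup>2) / (L2_set v S)\<^sup>2"
    by (simp add: normalized_on_def power_divide sum_divide_distrib)
  also have "\<dots> = 1" using False by (simp flip: L2_set_square)
  finally show ?thesis by simp
qed

lemma sum_normalized_on:
  assumes "S \<subseteq> {..<n}"
  shows "(\<Sum>i<n. normalized_on v S i * w i) = (\<Sum>i\<in>S. v i * w i) / L2_set v S"
proof -
  have "(\<Sum>i<n. normalized_on v S i * w i) = (\<Sum>i\<in>S. normalized_on v S i * w i)"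
    using assms by (intro sum.mono_neutral_right) (auto simp: normalized_on_def)
  also have "\<dots> = (\<Sum>i\<in>S. v i * w i) / L2_set v S"
    by (simp add: normalized_on_def sum_divide_distrib)
  finally show ?thesis .
qed

lemma sum_normalized_on_self:
  assumes "S \<subseteq> {..<n}"
  shows "(\<Sum>i<n. normalized_on v S i * v i) = L2_set v S"
proof -
  have "(\<Sum>i\<in>S. v i * v i) = L2_set v S * L2_set v S"
    using L2_set_square[of v S] by (simp add: power2_eq_square)
  then show ?thesis by (simp add: sum_normalized_on[OF assms])
qed

lemma sum_centered_on: "(\<Sum>i\<in>S. centered_on v S i) = 0"
  by (cases "finite S \<and> S \<noteq> {}") (auto simp: centered_on_def set_mean_def sum_subtractf)

text \<open>This orthogonality to constants removes the estimated probability \<open>p\<close> from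
  the signal.\<close>

lemma sum_normalized_centered_on:
  assumes "S \<subseteq> {..<n}"
  shows "(\<Sum>i<n. normalized_on (centered_on v S) S i) = 0"
  using sum_normalized_on[OF assms, of "centered_on v S" "\<lambda>_. 1"] by (simp add: sum_centered_on)

text \<open>As the test vector sums to zero, pairing it with \<open>v\<close> is the same as pairing
  it with the centred \<open>v\<close>.\<close>

lemma sum_normalized_centered_on_mult:
  assumes "S \<subseteq> {..<n}"
  shows "(\<Sum>i<n. normalized_on (centered_on v S) S i * v i) = L2_set (centered_on v S) S"
proof -
  let ?x = "normalized_on (centered_on v S) S"
  have "(\<Sum>i<n. ?x i * v i) = (\<Sum>i<n. ?x i * centered_on v S i + set_mean v S * ?x i)"
    by (simp add: centered_on_def algebra_simps)
  also have "\<dots> = (\<Sum>i<n. ?x i * centered_on v S i) + set_mean v S * (\<Sum>i<n. ?x i)"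
    by (simp add: sum.distrib sum_distrib_left)
  also have "\<dots> = L2_set (centered_on v S) S"
    by (simp add: sum_normalized_centered_on[OF assms] sum_normalized_on_self[OF assms])
  finally show ?thesis .
qed

section \<open>Lower bound on a block\<close>

lemma spectral_norm_A_tilde_ge_bilinear:
  assumes n: "n > 0" and x: "(\<Sum>i<n. (x i)\<^sup>2) \<le> 1" and y: "(\<Sum>i<n. (y i)\<^sup>2) \<le> 1"
  shows "spectral_norm (A_tilde n P a)
    \<ge> (\<Sum>i<n. \<Sum>j\<in>{..<n} - {i}. x i * A_tilde n P a $$ (i, j) * y j)"
proof -
  let ?X = "A_tilde n P a"
  have X: "?X \<in> carrier_mat n n" by (simp add: A_tilde_def)
  have "vec n x \<bullet> (?X *\<^sub>v vec n y) = (\<Sum>i<n. \<Sum>j<n. x i * ?X $$ (i, j) * y j)"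
    using X by (simp add: scalar_prod_def atLeast0LessThan sum_distrib_left mult_ac)
  also have "\<dots> = (\<Sum>i<n. \<Sum>j\<in>{..<n} - {i}. x i * ?X $$ (i, j) * y j)"
    by (intro sum.cong refl sum.mono_neutral_right) (auto simp: A_tilde_def)
  finally show ?thesis
    using spectral_norm_ge_bilinear[OF X n, of "vec n x" "vec n y"] x y
    by (simp add: scalar_prod_def atLeast0LessThan power2_eq_square)
qed

lemma A_tilde_scale_ge:
  fixes p :: real
  assumes n: "n > 1" and p: "0 < p" "p < 1"
  shows "1 / sqrt ((real n - 1) * p * (1 - p)) \<ge> 2 / sqrt (real n)"
proof -
  have "p * (1 - p) \<le> 1 / 4"
    using sum_power2_ge_zero[of "p - 1 / 2" 0] by (simp add: power2_eq_square algebra_simps)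
  then have "(real n - 1) * (p * (1 - p)) \<le> real n * (1 / 4)"
    using n p by (intro mult_mono) auto
  then have "sqrt ((real n - 1) * p * (1 - p)) \<le> sqrt (real n / 4)"
    by (simp add: mult.assoc)
  also have "\<dots> = sqrt (real n) / 2" by (simp add: real_sqrt_divide)
  finally have le: "sqrt ((real n - 1) * p * (1 - p)) \<le> sqrt (real n) / 2" .
  have "sqrt ((real n - 1) * p * (1 - p)) > 0" using n p by simp
  from divide_left_mono[OF le, of 1] this n show ?thesis by simp
qed

text \<open>With the diagonal included the sum factorises, and its \<open>p\<close> part vanishes by
  centring. The diagonal costs at most 1: \<open>\<psi> i * \<psi> i * b - p\<close> lies between -1
  and 1, and the \<open>|x i * y i|\<close> sum to at most 1.\<close>

lemma offdiag_rank_one_ge: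
  assumes S: "S \<subseteq> {..<n}" and T: "T \<subseteq> {..<n}" and \<psi>: "\<And>i. i < n \<Longrightarrow> \<psi> i \<in> {0..1::real}"
    and b: "b \<in> {0..1}" and p: "p \<in> {0..1}"
  defines "x \<equiv> normalized_on (centered_on \<psi> S) S" and "y \<equiv> normalized_on \<psi> T"
  shows "(\<Sum>i<n. \<Sum>j\<in>{..<n} - {i}. x i * (\<psi> i * \<psi> j * b - p) * y j)
    \<ge> b * L2_set (centered_on \<psi> S) S * L2_set \<psi> T - 1"
proof -
  let ?f = "\<lambda>i j. x i * (\<psi> i * \<psi> j * b - p) * y j"
  have diag: "?f i i \<le> ((x i)\<^sup>2 + (y i)\<^sup>2) / 2" if "i < n" for i
  proof -
    have "\<psi> i * \<psi> i * b \<le> 1 * 1 * 1" "0 \<le> \<psi> i * \<psi> i * b"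
      using \<psi>[OF that] b by (auto intro!: mult_mono mult_le_one)
    then have "\<bar>\<psi> i * \<psi> i * b - p\<bar> \<le> 1" using p by auto
    then have "\<bar>x i * y i\<bar> * \<bar>\<psi> i * \<psi> i * b - p\<bar> \<le> \<bar>x i * y i\<bar> * 1"
      by (intro mult_left_mono) auto
    moreover have "?f i i = (x i * y i) * (\<psi> i * \<psi> i * b - p)" by (simp only: mult_ac)
    ultimately have "?f i i \<le> \<bar>x i * y i\<bar>"
      using abs_ge_self[of "(x i * y i) * (\<psi> i * \<psi> i * b - p)"] by (simp only: abs_mult)
    also have "\<dots> \<le> ((x i)\<^sup>2 + (y i)\<^sup>2) / 2"
      using sum_squares_bound[of "\<bar>x i\<bar>" "\<bar>y i\<bar>"] by (simp add: abs_mult)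
    finally show ?thesis .
  qed
  have "(\<Sum>i<n. ?f i i) \<le> (\<Sum>i<n. ((x i)\<^sup>2 + (y i)\<^sup>2) / 2)"
    by (intro sum_mono diag) auto
  also have "\<dots> = ((\<Sum>i<n. (x i)\<^sup>2) + (\<Sum>i<n. (y i)\<^sup>2)) / 2"
    by (simp add: sum.distrib flip: sum_divide_distrib)
  also have "\<dots> \<le> 1"
    using sum_normalized_on_square_le[of "centered_on \<psi> S" S n] sum_normalized_on_square_le[of \<psi> T n]
    by (simp add: x_def y_def)
  finally have D: "(\<Sum>i<n. ?f i i) \<le> 1" .
  have "(\<Sum>i<n. \<Sum>j\<in>{..<n} - {i}. ?f i j) = (\<Sum>i<n. (\<Sum>j<n. ?f i j) - ?f i i)"
    by (intro sum.cong refl) (simp add: sum_diff1)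
  also have "\<dots> = (\<Sum>i<n. \<Sum>j<n. ?f i j) - (\<Sum>i<n. ?f i i)"
    by (rule sum_subtractf)
  also have "(\<Sum>i<n. \<Sum>j<n. ?f i j)
      = (\<Sum>i<n. \<Sum>j<n. b * ((x i * \<psi> i) * (y j * \<psi> j)) - p * (x i * y j))"
    by (intro sum.cong refl) (simp add: algebra_simps)
  also have "\<dots> = b * ((\<Sum>i<n. x i * \<psi> i) * (\<Sum>j<n. y j * \<psi> j)) - p * ((\<Sum>i<n. x i) * (\<Sum>j<n. y j))"
    unfolding sum_product by (simp add: sum_subtractf flip: sum_distrib_left)
  also have "\<dots> = b * L2_set (centered_on \<psi> S) S * L2_set \<psi> T"
    by (simp add: x_def y_def sum_normalized_centered_on_mult[OF S] sum_normalized_centered_on[OF S]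
        sum_normalized_on_self[OF T])
  finally show ?thesis using D by simp
qed

text \<open>On \<open>S \<times> T\<close> rescaling is multiplication by one constant
  \<open>s\<close>, and \<open>a - p\<close> splits into the noise \<open>a - Q\<close> and the
  rank-one signal minus \<open>p\<close>. Values of \<open>P\<close> and \<open>Q\<close> elsewhere
  do not affect the form, since \<open>x\<close> and \<open>y\<close> vanish outside
  \<open>S\<close> and \<open>T\<close>.\<close>

lemma spectral_norm_A_tilde_ge_block:
  assumes n: "n > 1" and S: "S \<subseteq> {..<n}" and T: "T \<subseteq> {..<n}"
    and \<psi>: "\<And>i. i < n \<Longrightarrow> \<psi> i \<in> {0..1::real}" and b: "b \<in> {0..1}" and p: "p \<in> {0..1}"
    and P: "\<And>i j. i \<in> S \<Longrightarrow> j \<in> T \<Longrightarrow> P i j = p"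
    and Q: "\<And>i j. i \<in> S \<Longrightarrow> j \<in> T \<Longrightarrow> Q i j = \<psi> i * \<psi> j * b"
    and ok: "\<And>i j. i < n \<Longrightarrow> j < n \<Longrightarrow> i \<noteq> j \<Longrightarrow> P i j \<in> {0, 1} \<Longrightarrow> a $$ (i, j) = P i j"
  defines "x \<equiv> normalized_on (centered_on \<psi> S) S" and "y \<equiv> normalized_on \<psi> T"
  shows "spectral_norm (A_tilde n P a) \<ge> 2 / sqrt (real n) *
    (b * L2_set (centered_on \<psi> S) S * L2_set \<psi> T - \<bar>noise_form n Q x y a\<bar> - 1)"
proof -
  define s where "s = (if p \<in> {0, 1} then 2 / sqrt (real n) else 1 / sqrt ((real n - 1) * p * (1 - p)))"
  txt \<open>If \<open>p \<in> {0, 1}\<close>, both sides of the entrywise identity below vanish and \<open>s\<close> is arbitrary.\<close>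
  have s: "s \<ge> 2 / sqrt (real n)" using A_tilde_scale_ge[OF n, of p] p by (auto simp: s_def)
  have x_out: "x i = 0" if "i \<notin> S" for i using that by (simp add: x_def normalized_on_def)
  have y_out: "y j = 0" if "j \<notin> T" for j using that by (simp add: y_def normalized_on_def)
  define D where "D = (\<Sum>i<n. \<Sum>j\<in>{..<n} - {i}. x i * (a $$ (i, j) - p) * y j)"
  have entry: "x i * A_tilde n P a $$ (i, j) * y j = s * (x i * (a $$ (i, j) - p) * y j)"
    if "i < n" "j < n" "j \<noteq> i" for i j
  proof (cases "i \<in> S \<and> j \<in> T")
    case True
    then have "P i j = p" using P by blast
    then show ?thesis
      using that ok[of i j] by (auto simp: A_tilde_def s_def)
  qed (auto simp: x_out y_out)
  have ge: "spectral_norm (A_tilde n P a)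
      \<ge> (\<Sum>i<n. \<Sum>j\<in>{..<n} - {i}. x i * A_tilde n P a $$ (i, j) * y j)"
    using n unfolding x_def y_def
    by (intro spectral_norm_A_tilde_ge_bilinear sum_normalized_on_square_le) auto
  also have "(\<Sum>i<n. \<Sum>j\<in>{..<n} - {i}. x i * A_tilde n P a $$ (i, j) * y j) = s * D"
    unfolding D_def sum_distrib_left by (intro sum.cong refl entry) auto
  finally have sD: "spectral_norm (A_tilde n P a) \<ge> s * D" .
  have nonneg: "spectral_norm (A_tilde n P a) \<ge> 0"
    using spectral_norm_A_tilde_ge_bilinear[of n "\<lambda>_. 0" "\<lambda>_. 0" P a] n by simp
  have "D = noise_form n Q x y a + (\<Sum>i<n. \<Sum>j\<in>{..<n} - {i}. x i * (Q i j - p) * y j)"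
    by (simp add: D_def noise_form_def algebra_simps flip: sum.distrib)
  also have "(\<Sum>i<n. \<Sum>j\<in>{..<n} - {i}. x i * (Q i j - p) * y j)
      = (\<Sum>i<n. \<Sum>j\<in>{..<n} - {i}. x i * (\<psi> i * \<psi> j * b - p) * y j)"
  proof (intro sum.cong refl)
    show "x i * (Q i j - p) * y j = x i * (\<psi> i * \<psi> j * b - p) * y j" for i j
      by (cases "i \<in> S \<and> j \<in> T") (auto simp: Q x_out y_out)
  qed
  finally have D_eq: "D = noise_form n Q x y a
      + (\<Sum>i<n. \<Sum>j\<in>{..<n} - {i}. x i * (\<psi> i * \<psi> j * b - p) * y j)" .
  have "(\<Sum>i<n. \<Sum>j\<in>{..<n} - {i}. x i * (\<psi> i * \<psi> j * b - p) * y j)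
      \<ge> b * L2_set (centered_on \<psi> S) S * L2_set \<psi> T - 1"
    unfolding x_def y_def by (rule offdiag_rank_one_ge[OF S T \<psi> b p])
  then have D: "D \<ge> b * L2_set (centered_on \<psi> S) S * L2_set \<psi> T - \<bar>noise_form n Q x y a\<bar> - 1"
    using D_eq abs_ge_minus_self[of "noise_form n Q x y a"] by linarith
  have "spectral_norm (A_tilde n P a) \<ge> 2 / sqrt (real n) * D"
  \<comment> \<open>Lowering \<open>s\<close> to \<open>2 / sqrt n\<close> decreases
    \<open>s * D\<close> only for nonnegative \<open>D\<close>; otherwise nonnegativity of the norm
    suffices.\<close>
  proof (cases "D \<ge> 0")
    case True
    then have "2 / sqrt (real n) * D \<le> s * D" using s by (intro mult_right_mono)
    with sD show ?thesis by simp
  next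
    case False
    then have "2 / sqrt (real n) * D \<le> 0" by (intro mult_nonneg_nonpos) auto
    with nonneg show ?thesis by simp
  qed
  moreover have "2 / sqrt (real n) * D \<ge> 2 / sqrt (real n) *
      (b * L2_set (centered_on \<psi> S) S * L2_set \<psi> T - \<bar>noise_form n Q x y a\<bar> - 1)"
    using D by (intro mult_left_mono) auto
  ultimately show ?thesis by linarith
qed

section \<open>Choice of the block\<close>

lemma sum_le_card_mult_some:
  fixes f :: "'a \<Rightarrow> real"
  assumes "finite I" "I \<noteq> {}"
  obtains i where "i \<in> I" "sum f I \<le> real (card I) * f i"
proof -
  obtain i where i: "i \<in> I" "f i = Max (f ` I)" using assms Max_in[of "f ` I"] by fastforce
  then have "sum f I \<le> real (card I) * f i"
    using assms by (intro sum_bounded_above) auto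
  with i(1) show ?thesis by (rule that)
qed

lemma sum_group_labels:
  assumes "finite N" "\<And>i. i \<in> N \<Longrightarrow> h i \<in> {1..L::nat}"
  shows "(\<Sum>c\<in>{1..L}. \<Sum>i\<in>{i\<in>N. h i = c}. f i) = sum f N"
  using assms by (intro sum.group) auto

lemma approx_error_le:
  assumes "card (u ` I) \<le> L"
  shows "approx_error I v L \<le> (L2_set (\<lambda>i. v i - u i) I)\<^sup>2"
  unfolding approx_error_def using assms
  by (intro cInf_lower) (auto intro!: bdd_belowI[of _ 0])

lemma approx_error_nonneg:
  assumes "L > 0"
  shows "approx_error I v L \<ge> 0"
proof -
  have "card ((\<lambda>_. 0 :: real) ` I) \<le> L"
    using assms by (simp add: image_constant_conv)
  then show ?thesis unfolding approx_error_def by (intro cInf_greatest) auto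
qed

text \<open>Comparison with the zero vector. In \<open>signal_ge\<close> this is what allows
  \<open>E * E \<le> E\<close>.\<close>

lemma approx_error_phi_tilde_le_1:
  assumes "L > 0"
  shows "approx_error (community n g k) (phi_tilde n g \<psi> k) L \<le> 1"
proof -
  have "card ((\<lambda>_. 0 :: real) ` community n g k) \<le> L"
    using assms by (simp add: image_constant_conv)
  from approx_error_le[OF this, of "phi_tilde n g \<psi> k"]
  have "approx_error (community n g k) (phi_tilde n g \<psi> k) L
      \<le> (\<Sum>i\<in>community n g k. (\<psi> i)\<^sup>2) / (phi_norm n g \<psi> k)\<^sup>2"
    by (simp add: L2_set_square phi_tilde_def power_divide sum_divide_distrib)
  also have "\<dots> \<le> 1" by (simp add: phi_norm_def L2_set_square)
  finally show ?thesis .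
qed

text \<open>Dividing a competitor \<open>u\<close> by the norm does not increase the number of its
  values, so the error scales with the squared norm.\<close>

lemma approx_error_scaled_le:
  assumes "card (u ` community n g k) \<le> L"
  shows "(phi_norm n g \<psi> k)\<^sup>2 * approx_error (community n g k) (phi_tilde n g \<psi> k) L
    \<le> (\<Sum>i\<in>community n g k. (\<psi> i - u i)\<^sup>2)"
proof (cases "phi_norm n g \<psi> k = 0")
  case True
  then show ?thesis by (simp add: sum_nonneg)
next
  case False
  let ?r = "phi_norm n g \<psi> k"
  let ?u = "\<lambda>i. u i / ?r"
  have "?u ` community n g k = (\<lambda>z. z / ?r) ` u ` community n g k" by (simp add: image_image)
  then have "card (?u ` community n g k) \<le> L"
    using card_image_le[of "u ` community n g k" "\<lambda>z. z / ?r"] assms by (simp add: community_def)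
  from approx_error_le[OF this, of "phi_tilde n g \<psi> k"]
  have "approx_error (community n g k) (phi_tilde n g \<psi> k) L
      \<le> (\<Sum>i\<in>community n g k. (\<psi> i - u i)\<^sup>2) / ?r\<^sup>2"
    by (simp add: L2_set_square phi_tilde_def power_divide sum_divide_distrib flip: diff_divide_distrib)
  with False show ?thesis by (simp add: field_simps)
qed

text \<open>Replacing \<open>\<psi>\<close> by its mean on each group gives a competitor with at
  most \<open>L\<close> values. Hence the total variation within groups is at least the left-hand
  side, and some group carries a share of at least \<open>1 / L\<close>.\<close>

lemma exists_deviating_group:
  assumes "L > 0" and h: "\<And>i. i < n \<Longrightarrow> h i \<in> {1..L}"
  obtains c where "c \<in> {1..L}"
    "(phi_norm n g \<psi> k)\<^sup>2 * approx_error (community n g k) (phi_tilde n g \<psi> k) L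
     \<le> real L * (L2_set (centered_on \<psi> {i \<in> community n g k. h i = c}) {i \<in> community n g k. h i = c})\<^sup>2"
proof -
  let ?N = "community n g k"
  let ?S = "\<lambda>c. {i \<in> ?N. h i = c}"
  define u where "u = (\<lambda>i. set_mean \<psi> (?S (h i)))"
  have hN: "h i \<in> {1..L}" if "i \<in> ?N" for i using h that by (simp add: community_def)
  have fin: "finite ?N" by (simp add: community_def)
  have "u ` ?N \<subseteq> (\<lambda>c. set_mean \<psi> (?S c)) ` {1..L}" using hN by (auto simp: u_def)
  then have "card (u ` ?N) \<le> L"
    using surj_card_le[of "{1..L}" "u ` ?N"] by simp
  from approx_error_scaled_le[OF this, of \<psi>]
  have "(phi_norm n g \<psi> k)\<^sup>2 * approx_error ?N (phi_tilde n g \<psi> k) L \<le> (\<Sum>i\<in>?N. (\<psi> i - u i)\<^sup>2)" .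
  also have "\<dots> = (\<Sum>c\<in>{1..L}. \<Sum>i\<in>?S c. (\<psi> i - u i)\<^sup>2)"
    by (rule sum_group_labels[OF fin hN, symmetric])
  also have "\<dots> = (\<Sum>c\<in>{1..L}. (L2_set (centered_on \<psi> (?S c)) (?S c))\<^sup>2)"
    by (simp add: L2_set_square centered_on_def u_def)
  finally have le: "(phi_norm n g \<psi> k)\<^sup>2 * approx_error ?N (phi_tilde n g \<psi> k) L
      \<le> (\<Sum>c\<in>{1..L}. (L2_set (centered_on \<psi> (?S c)) (?S c))\<^sup>2)" .
  obtain c where "c \<in> {1..L}"
    "(\<Sum>c\<in>{1..L}. (L2_set (centered_on \<psi> (?S c)) (?S c))\<^sup>2) \<le> real (card {1..L}) * (L2_set (centered_on \<psi> (?S c)) (?S c))\<^sup>2"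
    by (rule sum_le_card_mult_some[of "{1..L}" "\<lambda>c. (L2_set (centered_on \<psi> (?S c)) (?S c))\<^sup>2"])
      (use assms(1) in auto)
  with order_trans[OF le] show ?thesis by (intro that) simp_all
qed

lemma exists_heavy_group:
  assumes "L > 0" and h: "\<And>i. i < n \<Longrightarrow> h i \<in> {1..L}"
  obtains c where "c \<in> {1..L}"
    "(phi_norm n g \<psi> k)\<^sup>2 \<le> real L * (L2_set \<psi> {i \<in> community n g k. h i = c})\<^sup>2"
proof -
  let ?N = "community n g k"
  have hN: "h i \<in> {1..L}" if "i \<in> ?N" for i using h that by (simp add: community_def)
  have fin: "finite ?N" by (simp add: community_def)
  have "(phi_norm n g \<psi> k)\<^sup>2 \<le> (\<Sum>c\<in>{1..L}. \<Sum>i\<in>{i \<in> ?N. h i = c}. (\<psi> i)\<^sup>2)"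
    unfolding phi_norm_def L2_set_square by (rule eq_refl[OF sum_group_labels[OF fin hN, symmetric]])
  also have "\<dots> = (\<Sum>c\<in>{1..L}. (L2_set \<psi> {i \<in> ?N. h i = c})\<^sup>2)"
    by (simp add: L2_set_square)
  finally have le: "(phi_norm n g \<psi> k)\<^sup>2 \<le> (\<Sum>c\<in>{1..L}. (L2_set \<psi> {i \<in> ?N. h i = c})\<^sup>2)" .
  obtain c where "c \<in> {1..L}"
    "(\<Sum>c\<in>{1..L}. (L2_set \<psi> {i \<in> ?N. h i = c})\<^sup>2) \<le> real (card {1..L}) * (L2_set \<psi> {i \<in> ?N. h i = c})\<^sup>2"
    by (rule sum_le_card_mult_some[of "{1..L}" "\<lambda>c. (L2_set \<psi> {i \<in> ?N. h i = c})\<^sup>2"])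
      (use assms(1) in auto)
  with order_trans[OF le] show ?thesis by (intro that) simp_all
qed

text \<open>Multiplying the two pigeonhole bounds gives
  \<open>n * \<kappa> * E \<le> L * d * f\<close>, that is, the signal bound with constant
  \<open>2 * E / L\<close>; the stated constant is weaker because \<open>L \<ge> 1\<close>.\<close>

lemma signal_ge:
  fixes L :: nat
  assumes L: "L > 0" and n: "n > 0" and b: "b \<ge> 0" and \<kappa>: "\<kappa> \<ge> 0" and E: "0 \<le> E" "E \<le> 1"
    and k: "real n * \<kappa> \<le> \<Phi>\<^sub>1\<^sup>2" and l: "real n * \<kappa> \<le> \<Phi>\<^sub>2\<^sup>2"
    and d: "\<Phi>\<^sub>1\<^sup>2 * E \<le> real L * d\<^sup>2" "d \<ge> 0" and f: "\<Phi>\<^sub>2\<^sup>2 \<le> real L * f\<^sup>2" "f \<ge> 0"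
  shows "E / (2 * real L powr (3 / 2)) * b * \<kappa> * sqrt (real n) \<le> 2 / sqrt (real n) * (b * d * f)"
proof -
  have "(real n * \<kappa> * E)\<^sup>2 = (real n * \<kappa> * E * E) * (real n * \<kappa>)"
    by (simp add: power2_eq_square mult_ac)
  \<comment> \<open>One factor \<open>E\<close> is given up, since only the first of the two groups
    carries it.\<close>
  also have "\<dots> \<le> (\<Phi>\<^sub>1\<^sup>2 * E) * \<Phi>\<^sub>2\<^sup>2"
  proof (rule mult_mono)
    have "real n * \<kappa> * E * E \<le> real n * \<kappa> * E" using \<kappa> E by (intro mult_left_le) auto
    also have "\<dots> \<le> \<Phi>\<^sub>1\<^sup>2 * E" using k E by (intro mult_right_mono) auto
    finally show "real n * \<kappa> * E * E \<le> \<Phi>\<^sub>1\<^sup>2 * E" .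
  qed (use \<kappa> E l in auto)
  also have "\<dots> \<le> (real L * d\<^sup>2) * (real L * f\<^sup>2)"
    by (rule mult_mono) (use d f in auto)
  also have "\<dots> = (real L * d * f)\<^sup>2" by (simp add: power2_eq_square mult_ac)
  finally have main: "real n * \<kappa> * E \<le> real L * d * f"
    by (rule power2_le_imp_le) (use d f in auto)
  have L1: "real L \<ge> 1" using L by simp
  then have "real L powr 1 \<le> real L powr (3 / 2)" by (intro powr_mono) auto
  then have "real L \<le> 2 * real L powr (3 / 2)" using L1 by simp
  then have "E / (2 * real L powr (3 / 2)) \<le> E / real L"
    using E L1 by (intro divide_left_mono) auto
  then have "E / (2 * real L powr (3 / 2)) * (b * \<kappa> * sqrt (real n)) \<le> E / real L * (b * \<kappa> * sqrt (real n))"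
    using b \<kappa> by (intro mult_right_mono) auto
  also have "\<dots> = (real n * \<kappa> * E) * b / (real L * sqrt (real n))"
    using n by (simp add: divide_simps)
  also have "\<dots> \<le> (real L * d * f) * b / (real L * sqrt (real n))"
    using main b by (intro divide_right_mono mult_right_mono) auto
  also have "\<dots> = 1 / sqrt (real n) * (b * d * f)" using L1 by (simp add: field_simps)
  also have "\<dots> \<le> 2 / sqrt (real n) * (b * d * f)"
    using b d f by (intro mult_right_mono divide_right_mono) auto
  finally show ?thesis by (simp add: mult.assoc)
qed

section \<open>Deterministic bound for a fixed adjacency matrix, and the conclusion\<close>

lemma kappa_le:
  assumes "n > 0" "k \<in> {1..K}"
  shows "real n * kappa n K g \<psi> \<le> (phi_norm n g \<psi> k)\<^sup>2"
proof -
  have "kappa n K g \<psi> \<le> (phi_norm n g \<psi> k)\<^sup>2 / real n"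
    unfolding kappa_def using assms by (intro Min_le) auto
  then show ?thesis using assms(1) by (simp add: field_simps)
qed

lemma kappa_nonneg:
  assumes "k \<in> {1..K}"
  shows "kappa n K g \<psi> \<ge> 0"
proof -
  have "kappa n K g \<psi> \<in> (\<lambda>k. (phi_norm n g \<psi> k)\<^sup>2 / real n) ` {1..K}"
    unfolding kappa_def using assms by (intro Min_in) auto
  then show ?thesis by auto
qed

text \<open>All randomness is confined to the bound \<open>z\<close>, which has to be uniform in
  \<open>S\<close> and \<open>T\<close> because these are cut out by labels estimated from
  \<open>a\<close> itself.\<close>

lemma A_tilde_norm_ge:
  fixes \<psi> :: "nat \<Rightarrow> real" and gh :: "real mat \<Rightarrow> nat \<Rightarrow> nat" and Bh :: "real mat \<Rightarrow> nat \<Rightarrow> nat \<Rightarrow> real"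
  assumes n: "n > 1" and B: "sbm_parameters n K g B" and \<psi>: "\<And>i. i < n \<Longrightarrow> \<psi> i \<in> {0..1}"
    and a: "a \<in> adjacency_matrices n" and L: "L > 0" and est: "sbm_estimator n L gh Bh"
    and k: "k \<in> {1..K}"
    and Z: "\<And>S T. S \<subseteq> {..<n} \<Longrightarrow> T \<subseteq> {..<n} \<Longrightarrow>
      \<bar>noise_form n (dcbm_mean g B \<psi>) (normalized_on (centered_on \<psi> S) S) (normalized_on \<psi> T) a\<bar> \<le> z"
  shows "A_tilde_norm n (P_hat gh Bh a) a \<ge>
    ereal (approx_error (community n g k) (phi_tilde n g \<psi> k) L / (2 * real L powr (3 / 2))
      * row_max K B k * kappa n K g \<psi> * sqrt (real n) + - (2 / sqrt (real n)) * (z + 1))"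
    (is "_ \<ge> ereal ?rhs")
proof (cases "\<exists>i<n. \<exists>j<n. i \<noteq> j \<and> P_hat gh Bh a i j \<in> {0, 1} \<and> a $$ (i, j) \<noteq> P_hat gh Bh a i j")
  case True
  then show ?thesis unfolding A_tilde_norm_def by (simp only: if_True) simp
next
  case False
  have h: "gh a i \<in> {1..L}" if "i < n" for i
    using est a that by (simp add: sbm_estimator_def sbm_parameters_def)
  have "row_max K B k \<in> B k ` {1..K}" unfolding row_max_def using k by (intro Max_in) auto
  \<comment> \<open>The maximising community may be \<open>k\<close> itself. The two node sets may
    then overlap, which the treatment of the diagonal allows for.\<close>
  then obtain l where l: "l \<in> {1..K}" "row_max K B k = B k l" by blast
  have b: "B k l \<in> {0..1}" using B k l(1) by (auto simp: sbm_parameters_def)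
  let ?S = "\<lambda>c. {i \<in> community n g k. gh a i = c}" and ?T = "\<lambda>c. {i \<in> community n g l. gh a i = c}"
  obtain c where c: "c \<in> {1..L}"
    "(phi_norm n g \<psi> k)\<^sup>2 * approx_error (community n g k) (phi_tilde n g \<psi> k) L
     \<le> real L * (L2_set (centered_on \<psi> (?S c)) (?S c))\<^sup>2"
    by (rule exists_deviating_group[OF L h])
  obtain d where d: "d \<in> {1..L}" "(phi_norm n g \<psi> l)\<^sup>2 \<le> real L * (L2_set \<psi> (?T d))\<^sup>2"
    by (rule exists_heavy_group[OF L h])
  have sub: "?S c \<subseteq> {..<n}" "?T d \<subseteq> {..<n}" by (auto simp: community_def)
  have p: "Bh a c d \<in> {0..1}"
    using est a c(1) d(1) unfolding sbm_estimator_def sbm_parameters_def by blast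
  have "?rhs \<le> 2 / sqrt (real n) * (B k l * L2_set (centered_on \<psi> (?S c)) (?S c) * L2_set \<psi> (?T d))
      + - (2 / sqrt (real n)) * (z + 1)"
    unfolding l(2) using n b k l(1) c(2) d(2) kappa_nonneg[OF k] approx_error_nonneg[OF L]
      approx_error_phi_tilde_le_1[OF L]
    by (intro add_right_mono signal_ge[OF L]) (auto intro!: kappa_le)
  also have "\<dots> = 2 / sqrt (real n) *
      (B k l * L2_set (centered_on \<psi> (?S c)) (?S c) * L2_set \<psi> (?T d) - z - 1)"
    by (simp add: algebra_simps)
  also have "\<dots> \<le> 2 / sqrt (real n) * (B k l * L2_set (centered_on \<psi> (?S c)) (?S c) * L2_set \<psi> (?T d)
      - \<bar>noise_form n (dcbm_mean g B \<psi>) (normalized_on (centered_on \<psi> (?S c)) (?S c))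
          (normalized_on \<psi> (?T d)) a\<bar> - 1)"
    using Z[OF sub] by (intro mult_left_mono) auto
  also have "\<dots> \<le> spectral_norm (A_tilde n (P_hat gh Bh a) a)"
    using False
    by (intro spectral_norm_A_tilde_ge_block[OF n sub \<psi> b p])
      (auto simp: P_hat_def dcbm_mean_def community_def)
  finally show ?thesis unfolding A_tilde_norm_def using False by (simp only: if_False ereal_less_eq)
qed

theorem theorem3p5:
  fixes M :: "nat \<Rightarrow> 'w measure"
    and K K0 kstar :: "nat \<Rightarrow> nat"
    and g :: "nat \<Rightarrow> nat \<Rightarrow> nat"
    and B :: "nat \<Rightarrow> nat \<Rightarrow> nat \<Rightarrow> real"
    and \<psi> :: "nat \<Rightarrow> nat \<Rightarrow> real"
    and A :: "nat \<Rightarrow> 'w \<Rightarrow> real mat"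
    and ghat :: "nat \<Rightarrow> real mat \<Rightarrow> nat \<Rightarrow> nat"
    and Bhat :: "nat \<Rightarrow> real mat \<Rightarrow> nat \<Rightarrow> nat \<Rightarrow> real"
  assumes "\<And>n. dcbm (M n) n (K n) (g n) (B n) (\<psi> n) (A n)"
    and "\<And>n. K0 n > 0"
    and "\<forall>\<^sub>F n in sequentially. kstar n \<in> {1..K n} \<and>
           approx_error (community n (g n) (kstar n)) (phi_tilde n (g n) (\<psi> n) (kstar n)) (K0 n) > 0"
    and "\<And>n. sbm_estimator n (K0 n) (ghat n) (Bhat n)"
  shows "\<exists>R. bounded_in_probability M R \<and>
    (\<forall>\<^sub>F n in sequentially. \<forall>\<omega>\<in>space (M n).
       A_tilde_norm n (P_hat (ghat n) (Bhat n) (A n \<omega>)) (A n \<omega>) \<ge>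
       ereal (approx_error (community n (g n) (kstar n)) (phi_tilde n (g n) (\<psi> n) (kstar n)) (K0 n)
                / (2 * real (K0 n) powr (3 / 2))
              * row_max (K n) (B n) (kstar n) * kappa n (K n) (g n) (\<psi> n) * sqrt (real n)
              + R n \<omega>))"
proof (intro exI conjI)
  define u where "u = (\<lambda>n S. normalized_on (centered_on (\<psi> n) S) S)"
  define v where "v = (\<lambda>n. normalized_on (\<psi> n))"
  \<comment> \<open>This maximum involves only the true parameters and \<open>A\<close>; the
    estimator merely selects one of the pairs over which it is taken.\<close>
  define m where "m = (\<lambda>n \<omega>. Max ((\<lambda>(S, T).
      \<bar>noise_form n (dcbm_mean (g n) (B n) (\<psi> n)) (u n S) (v n T) (A n \<omega>)\<bar>)
       ` (Pow {..<n} \<times> Pow {..<n})))"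
  show "bounded_in_probability M (\<lambda>n \<omega>. - (2 / sqrt (real n)) * (m n \<omega> + 1))"
    unfolding m_def
    by (rule bounded_in_probability_of_noise_max[OF assms(1)])
      (simp_all only: u_def v_def sum_normalized_on_square_le)
  show "\<forall>\<^sub>F n in sequentially. \<forall>\<omega>\<in>space (M n).
       A_tilde_norm n (P_hat (ghat n) (Bhat n) (A n \<omega>)) (A n \<omega>) \<ge>
       ereal (approx_error (community n (g n) (kstar n)) (phi_tilde n (g n) (\<psi> n) (kstar n)) (K0 n)
                / (2 * real (K0 n) powr (3 / 2))
              * row_max (K n) (B n) (kstar n) * kappa n (K n) (g n) (\<psi> n) * sqrt (real n)
              + - (2 / sqrt (real n)) * (m n \<omega> + 1))"
    using assms(3) eventually_gt_at_top[of 1]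
  proof eventually_elim
    case (elim n)
    show ?case
    proof
      fix \<omega> assume \<omega>: "\<omega> \<in> space (M n)"
      have D: "sbm_parameters n (K n) (g n) (B n)" "\<And>i. i < n \<Longrightarrow> \<psi> n i \<in> {0..1}"
        "A n \<omega> \<in> adjacency_matrices n"
        using assms(1)[of n] \<omega> unfolding dcbm_def by blast+
      have Z: "\<bar>noise_form n (dcbm_mean (g n) (B n) (\<psi> n)) (normalized_on (centered_on (\<psi> n) S) S)
          (normalized_on (\<psi> n) T) (A n \<omega>)\<bar> \<le> m n \<omega>" if "S \<subseteq> {..<n}" "T \<subseteq> {..<n}" for S T
        unfolding m_def u_def v_def using that by (intro Max_ge) (auto intro!: image_eqI[of _ _ "(S, T)"])
      show "A_tilde_norm n (P_hat (ghat n) (Bhat n) (A n \<omega>)) (A n \<omega>) \<ge>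
       ereal (approx_error (community n (g n) (kstar n)) (phi_tilde n (g n) (\<psi> n) (kstar n)) (K0 n)
                / (2 * real (K0 n) powr (3 / 2))
              * row_max (K n) (B n) (kstar n) * kappa n (K n) (g n) (\<psi> n) * sqrt (real n)
              + - (2 / sqrt (real n)) * (m n \<omega> + 1))"
        using A_tilde_norm_ge[OF _ D assms(2) assms(4) _ Z] elim by blast
    qed
  qed
qed

end
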